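(* Let $G$ be a finite Heisenberg group, i.e. a Heisenberg group given by a central extension $1 \to U(1) \to G \xrightarrow{\pi} K \to 0$ with $K$ a finite abelian group, and let $\rho$ be its canonical representation, acting on the space $V$. Then every maximal $\rho$-inductive algebra $\mathcal{A} \subseteq \mathrm{End}(V)$ is of the form $\mathcal{A}(M)$ for a maximal isotropic subgroup $M$ of $K$. In particular, all maximal $\rho$-inductive algebras are maximal abelian subalgebras of $\mathrm{End}(V)$ and are self-adjoint.
   Context: Let $U(1)=\{z\in\mathbb{C} : |z|=1\}$. Let $K$ be a finite abelian group (written additively, with the discrete topology) and let $G$ be a locally compact group lying in a central extension $1\to U(1)\to G\xrightarrow{\pi} K\to 0$. Choose a section $s:K\to G$ of $\pi$ (a map, not necessarily a homomorphism, with $\pi\circ s=\mathrm{Id}_K$) and define $e:K\times K\to U(1)$ by $e(k,l)=s(k)s(l)s(k)^{-1}s(l)^{-1}$. This is independent of $s$ and is an alternating bicharacter: a homomorphism in each variable with $e(k,k)=1$ for all $k$. Let $\widehat{K}$ be the Pontryagin dual of $K$ and define $e^\flat:K\to\widehat{K}$ by $(e^\flat(l))(k)=e(k,l)$. The group $G$ is called a Heisenberg group if $e^\flat$ is an isomorphism; then the center is $Z(G)=U(1)$. Isotropic subgroups: a subgroup $M\subseteq K$ is isotropic if $e(k,l)=1$ for all $k,l\in M$; a maximal isotropic subgroup is a maximal element, under inclusion, of the set of isotropic subgroups. Canonical representation: for a maximal isotropic subgroup $M$ of $K$, the group $\pi^{-1}(M)$ is abelian, and there is a (continuous, unitary) character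 $\chi:\pi^{-1}(M)\to U(1)$ with $\chi|_{Z(G)}=\mathrm{id}_{U(1)}$. Put $$V_{M,\chi}=\{f:G\to\mathbb{C} \mid f(hg')=\chi(h)f(g')\text{ for all }h\in\pi^{-1}(M),\ g'\in G\},$$ with $G$ acting by $(\rho_{M,\chi}(g)f)(g')=f(g'g)$. This is the induced representation $\mathrm{Ind}_{\pi^{-1}(M)}^G\chi$; it is finite-dimensional, irreducible and unitarizable, and $Z(G)=U(1)$ acts by scalars through the identity character. By the Stone–von Neumann–Mackey theorem, every irreducible representation of $G$ on which $z\in Z(G)=U(1)$ acts as $z\cdot I$ is isomorphic to $\rho_{M,\chi}$, so up to isomorphism $\rho_{M,\chi}$ does not depend on $M$ or $\chi$. The canonical representation $\rho$ on $V$ is this representation (realized on $V=V_{M_0,\chi_0}$ for some choice $(M_0,\chi_0)$), with $V$ carrying a $G$-invariant inner product (unique up to a positive scalar). The algebra $\mathcal{A}(M)$: for a maximal isotropic subgroup $M$ and a (continuous, unitary) character $\chi:\pi^{-1}(M)\to U(1)$ with $\chi|_{Z(G)}=\mathrm{id}_{U(1)}$, let $$\mathcal{A}(M)=\{m_u \mid u:G\to\mathbb{C},\ u(hg')=u(g')\text{ for all }h\in\pi^{-1}(M),\ g'\in G\}\subseteq\mathrm{End}(V_{M,\chi}),$$ where $m_u(f)=uf$ (pointwise multiplication). It is regarded as a subalgebra of $\mathrm{End}(V)$ via an isomorphism of $G$-representations $\Phi:V\to V_{M,\chi}$, i.e. as $\{\Phi^{-1}m_u\Phi\}$; the resulting subalgebra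 of $\mathrm{End}(V)$ does not depend on the choice of $\chi$ and $\Phi$. Inductive algebras: a $\rho$-inductive algebra is a (weakly closed, which is automatic here since $V$ is finite-dimensional) abelian subalgebra $\mathcal{A}\subseteq\mathrm{End}(V)$ with $\rho(g)\mathcal{A}\rho(g)^{-1}=\mathcal{A}$ for every $g\in G$. A maximal $\rho$-inductive algebra is a maximal element, under inclusion, of the set of $\rho$-inductive algebras. A maximal abelian subalgebra is a maximal element, under inclusion, of the set of abelian subalgebras of $\mathrm{End}(V)$. Self-adjoint means closed under taking adjoints with respect to the $G$-invariant inner product on $V$. *)

theory Defs
  imports "HOL-Algebra.Coset" "HOL-Analysis.Analysis"
begin

section \<open>The circle group and Pontryagin duals\<close>

definition circle_group :: "complex monoid"
  where "circle_group = \<lparr>carrier = sphere 0 1, monoid.mult = (*), one = 1\<rparr>"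

definition circle_topology :: "complex topology"
  where "circle_topology = top_of_set (sphere 0 1)"

text \<open>Continuous unitary characters.  They are extensional, so that equality of
  characters is equality of functions on the carrier.\<close>

definition unitary_characters :: "('a, 'b) monoid_scheme \<Rightarrow> 'a topology \<Rightarrow> ('a \<Rightarrow> complex) set"
  where "unitary_characters H X =
    {\<xi> \<in> hom H circle_group \<inter> extensional (carrier H). continuous_map X circle_topology \<xi>}"

text \<open>Only the group structure of the dual is recorded.  The dual of a finite discrete group
  is finite and discrete, so isomorphisms onto it need no topological condition.\<close>

definition pontryagin_dual :: "('a, 'b) monoid_scheme \<Rightarrow> 'a topology \<Rightarrow> ('a \<Rightarrow> complex) monoid"
  where "pontryagin_dual H X =
    \<lparr>carrier = unitary_characters H X,
     monoid.mult = (\<lambda>\<xi> \<psi>. \<lambda>x\<in>carrier H. \<xi> x * \<psi> x),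
     one = (\<lambda>x\<in>carrier H. 1)\<rparr>"


section \<open>Central extensions of finite abelian groups by the circle\<close>

text \<open>The group \<open>K\<close> carries the discrete topology; it is written multiplicatively,
  as is usual for \<^locale>\<open>comm_group\<close>.  The map \<open>\<iota>\<close> is the
  inclusion of the circle into \<open>G\<close>.\<close>

locale circle_extension =
  fixes G :: "('g, 'm) monoid_scheme" and X :: "'g topology"
    and K :: "('k, 'n) monoid_scheme"
    and \<iota> :: "complex \<Rightarrow> 'g" and \<pi> :: "'g \<Rightarrow> 'k"
  assumes group_G: "group G"
    and topspace_X: "topspace X = carrier G"
    and mult_continuous: "continuous_map (prod_topology X X) X (\<lambda>(x, y). x \<otimes>\<^bsub>G\<^esub> y)"
    and inv_continuous: "continuous_map X X (\<lambda>x. inv\<^bsub>G\<^esub> x)"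
    and Hausdorff_X: "Hausdorff_space X"
    and locally_compact_X: "locally_compact_space X"
    and comm_group_K: "comm_group K"
    and finite_K: "finite (carrier K)"
    and iota_hom: "\<iota> \<in> hom circle_group G"
    and iota_embedding: "embedding_map circle_topology X \<iota>"
    and pi_hom: "\<pi> \<in> hom G K"
    and pi_continuous: "continuous_map X (discrete_topology (carrier K)) \<pi>"
    and pi_surj: "\<pi> ` carrier G = carrier K"
    and exact: "kernel G K \<pi> = \<iota> ` carrier circle_group"
    and central: "\<And>z x. z \<in> carrier circle_group \<Longrightarrow> x \<in> carrier G \<Longrightarrow>
                     \<iota> z \<otimes>\<^bsub>G\<^esub> x = x \<otimes>\<^bsub>G\<^esub> \<iota> z"

text \<open>The commutator form, computed with the section \<open>inv_into (carrier G) \<pi>\<close>; commutators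
  lie in the image of \<open>\<iota>\<close> and are pulled back to the circle.  The lemma
  \<open>commutator_form_eq\<close> below shows that the choice of section is irrelevant.\<close>

definition commutator_form ::
    "('g, 'm) monoid_scheme \<Rightarrow> (complex \<Rightarrow> 'g) \<Rightarrow> ('g \<Rightarrow> 'k) \<Rightarrow> 'k \<Rightarrow> 'k \<Rightarrow> complex"
  where "commutator_form G \<iota> \<pi> k l =
    (let s = inv_into (carrier G) \<pi> in
     inv_into (carrier circle_group) \<iota>
       (s k \<otimes>\<^bsub>G\<^esub> s l \<otimes>\<^bsub>G\<^esub> inv\<^bsub>G\<^esub> (s k) \<otimes>\<^bsub>G\<^esub> inv\<^bsub>G\<^esub> (s l)))"

locale heisenberg_group = circle_extension +
  assumes duality:
    "(\<lambda>l\<in>carrier K. \<lambda>k\<in>carrier K. commutator_form G \<iota> \<pi> k l)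
       \<in> iso K (pontryagin_dual K (discrete_topology (carrier K)))"

lemma (in circle_extension) commutator_form_eq:
  assumes x: "x \<in> carrier G" and y: "y \<in> carrier G"
  shows "commutator_form G \<iota> \<pi> (\<pi> x) (\<pi> y) \<in> carrier circle_group"
    and "\<iota> (commutator_form G \<iota> \<pi> (\<pi> x) (\<pi> y)) =
           x \<otimes>\<^bsub>G\<^esub> y \<otimes>\<^bsub>G\<^esub> inv\<^bsub>G\<^esub> x \<otimes>\<^bsub>G\<^esub> inv\<^bsub>G\<^esub> y"
proof -
  interpret G: group G by (rule group_G)
  interpret K: comm_group K by (rule comm_group_K)
  interpret P: group_hom G K \<pi>
    using pi_hom by unfold_locales
  have lift: "\<exists>z\<in>carrier circle_group. u = \<iota> z \<otimes>\<^bsub>G\<^esub> v"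
    if u: "u \<in> carrier G" and v: "v \<in> carrier G" and eq: "\<pi> u = \<pi> v" for u v
  proof -
    have "u \<otimes>\<^bsub>G\<^esub> inv\<^bsub>G\<^esub> v \<in> kernel G K \<pi>"
      using u v eq by (simp add: kernel_def)
    then obtain z where "z \<in> carrier circle_group" "u \<otimes>\<^bsub>G\<^esub> inv\<^bsub>G\<^esub> v = \<iota> z"
      using exact by auto
    then show ?thesis
      using u v by (metis G.inv_closed G.m_assoc G.l_inv G.r_one)
  qed
  define s where "s = inv_into (carrier G) \<pi>"
  have s: "s (\<pi> u) \<in> carrier G" "\<pi> (s (\<pi> u)) = \<pi> u" if "u \<in> carrier G" for u
    using that by (auto simp: s_def inv_into_into f_inv_into_f)
  let ?a = "s (\<pi> x)" and ?b = "s (\<pi> y)"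
  let ?c = "?a \<otimes>\<^bsub>G\<^esub> ?b \<otimes>\<^bsub>G\<^esub> inv\<^bsub>G\<^esub> ?a \<otimes>\<^bsub>G\<^esub> inv\<^bsub>G\<^esub> ?b"
  have "?c \<in> kernel G K \<pi>"
    using s x y K.m_comm[of "\<pi> x" "\<pi> y"]
    by (simp add: kernel_def K.m_assoc flip: K.inv_mult)
  then have c: "?c \<in> \<iota> ` carrier circle_group" using exact by simp
  obtain z w where z: "z \<in> carrier circle_group" "x = \<iota> z \<otimes>\<^bsub>G\<^esub> ?a"
    and w: "w \<in> carrier circle_group" "y = \<iota> w \<otimes>\<^bsub>G\<^esub> ?b"
    using lift[of x ?a] lift[of y ?b] s x y by metis
  have zw: "\<iota> z \<in> carrier G" "\<iota> w \<in> carrier G"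
    using z w iota_hom by (auto simp: hom_def)
  have inv_swap: "t \<otimes>\<^bsub>G\<^esub> p \<otimes>\<^bsub>G\<^esub> q \<otimes>\<^bsub>G\<^esub> inv\<^bsub>G\<^esub> (t \<otimes>\<^bsub>G\<^esub> p) \<otimes>\<^bsub>G\<^esub> r = p \<otimes>\<^bsub>G\<^esub> q \<otimes>\<^bsub>G\<^esub> inv\<^bsub>G\<^esub> p \<otimes>\<^bsub>G\<^esub> r"
    if "t \<in> \<iota> ` carrier circle_group" "t \<in> carrier G" "p \<in> carrier G" "q \<in> carrier G" "r \<in> carrier G" for t p q r
  proof -
    have cen: "t \<otimes>\<^bsub>G\<^esub> v = v \<otimes>\<^bsub>G\<^esub> t" if "v \<in> carrier G" for v
      using central \<open>t \<in> \<iota> ` _\<close> that by auto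
    have "t \<otimes>\<^bsub>G\<^esub> p \<otimes>\<^bsub>G\<^esub> q \<otimes>\<^bsub>G\<^esub> inv\<^bsub>G\<^esub> (t \<otimes>\<^bsub>G\<^esub> p) = (t \<otimes>\<^bsub>G\<^esub> (p \<otimes>\<^bsub>G\<^esub> q \<otimes>\<^bsub>G\<^esub> inv\<^bsub>G\<^esub> p)) \<otimes>\<^bsub>G\<^esub> inv\<^bsub>G\<^esub> t"
      using that by (simp add: G.inv_mult_group G.m_assoc)
    also have "\<dots> = p \<otimes>\<^bsub>G\<^esub> q \<otimes>\<^bsub>G\<^esub> inv\<^bsub>G\<^esub> p"
      using that by (simp add: cen G.m_assoc)
    finally show ?thesis by simp
  qed
  have cenw: "\<iota> w \<otimes>\<^bsub>G\<^esub> v = v \<otimes>\<^bsub>G\<^esub> \<iota> w" if "v \<in> carrier G" for v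
    using central w that by auto
  have "x \<otimes>\<^bsub>G\<^esub> y \<otimes>\<^bsub>G\<^esub> inv\<^bsub>G\<^esub> x \<otimes>\<^bsub>G\<^esub> inv\<^bsub>G\<^esub> y = ?a \<otimes>\<^bsub>G\<^esub> y \<otimes>\<^bsub>G\<^esub> inv\<^bsub>G\<^esub> ?a \<otimes>\<^bsub>G\<^esub> inv\<^bsub>G\<^esub> y"
    using inv_swap[of "\<iota> z" ?a y "inv\<^bsub>G\<^esub> y"] z zw s x y by auto
  also have "\<dots> = ?a \<otimes>\<^bsub>G\<^esub> (\<iota> w \<otimes>\<^bsub>G\<^esub> ?b) \<otimes>\<^bsub>G\<^esub> inv\<^bsub>G\<^esub> ?a \<otimes>\<^bsub>G\<^esub> inv\<^bsub>G\<^esub> (\<iota> w \<otimes>\<^bsub>G\<^esub> ?b)"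
    using w(2) by simp
  also have "\<dots> = (\<iota> w \<otimes>\<^bsub>G\<^esub> (?a \<otimes>\<^bsub>G\<^esub> ?b \<otimes>\<^bsub>G\<^esub> inv\<^bsub>G\<^esub> ?a \<otimes>\<^bsub>G\<^esub> inv\<^bsub>G\<^esub> ?b)) \<otimes>\<^bsub>G\<^esub> inv\<^bsub>G\<^esub> (\<iota> w)"
    using s x y zw cenw[of ?a] by (simp add: G.inv_mult_group flip: G.m_assoc)
  also have "\<dots> = ?c"
    using s x y zw by (simp add: cenw G.m_assoc)
  finally have eq: "x \<otimes>\<^bsub>G\<^esub> y \<otimes>\<^bsub>G\<^esub> inv\<^bsub>G\<^esub> x \<otimes>\<^bsub>G\<^esub> inv\<^bsub>G\<^esub> y = ?c" .
  have def: "commutator_form G \<iota> \<pi> (\<pi> x) (\<pi> y) = inv_into (carrier circle_group) \<iota> ?c"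
    by (simp add: commutator_form_def s_def Let_def)
  show "commutator_form G \<iota> \<pi> (\<pi> x) (\<pi> y) \<in> carrier circle_group"
    unfolding def by (rule inv_into_into[OF c])
  show "\<iota> (commutator_form G \<iota> \<pi> (\<pi> x) (\<pi> y)) =
           x \<otimes>\<^bsub>G\<^esub> y \<otimes>\<^bsub>G\<^esub> inv\<^bsub>G\<^esub> x \<otimes>\<^bsub>G\<^esub> inv\<^bsub>G\<^esub> y"
    unfolding def eq by (rule f_inv_into_f[OF c])
qed


section \<open>Isotropic subgroups\<close>

definition maximal_set :: "('a set \<Rightarrow> bool) \<Rightarrow> 'a set \<Rightarrow> bool"
  where "maximal_set P A \<longleftrightarrow> P A \<and> (\<forall>B. P B \<and> A \<subseteq> B \<longrightarrow> B = A)"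

definition isotropic :: "('g, 'm) monoid_scheme \<Rightarrow> ('k, 'n) monoid_scheme \<Rightarrow>
    (complex \<Rightarrow> 'g) \<Rightarrow> ('g \<Rightarrow> 'k) \<Rightarrow> 'k set \<Rightarrow> bool"
  where "isotropic G K \<iota> \<pi> M \<longleftrightarrow>
    subgroup M K \<and> (\<forall>k\<in>M. \<forall>l\<in>M. commutator_form G \<iota> \<pi> k l = 1)"

abbreviation maximal_isotropic :: "('g, 'm) monoid_scheme \<Rightarrow> ('k, 'n) monoid_scheme \<Rightarrow>
    (complex \<Rightarrow> 'g) \<Rightarrow> ('g \<Rightarrow> 'k) \<Rightarrow> 'k set \<Rightarrow> bool"
  where "maximal_isotropic G K \<iota> \<pi> \<equiv> maximal_set (isotropic G K \<iota> \<pi>)"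

definition ext_preimage :: "('g, 'm) monoid_scheme \<Rightarrow> ('g \<Rightarrow> 'k) \<Rightarrow> 'k set \<Rightarrow> 'g set"
  where "ext_preimage G \<pi> M = {g \<in> carrier G. \<pi> g \<in> M}"

definition central_characters :: "('g, 'm) monoid_scheme \<Rightarrow> 'g topology \<Rightarrow>
    (complex \<Rightarrow> 'g) \<Rightarrow> ('g \<Rightarrow> 'k) \<Rightarrow> 'k set \<Rightarrow> ('g \<Rightarrow> complex) set"
  where "central_characters G X \<iota> \<pi> M =
    {\<xi> \<in> unitary_characters (G\<lparr>carrier := ext_preimage G \<pi> M\<rparr>)
             (subtopology X (ext_preimage G \<pi> M)).
       \<forall>z\<in>carrier circle_group. \<xi> (\<iota> z) = z}"


section \<open>Linear maps and algebras of operators on spaces of functions\<close>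

text \<open>All vector spaces here are complex linear subspaces of \<open>'g \<Rightarrow> complex\<close> with the
  pointwise operations.  Operators on \<open>V\<close> are extensional functions on \<open>V\<close>, so that they
  are equal as soon as they agree on \<open>V\<close>.\<close>

type_synonym 'g operator = "('g \<Rightarrow> complex) \<Rightarrow> ('g \<Rightarrow> complex)"

definition linear_between :: "('g \<Rightarrow> complex) set \<Rightarrow> ('g \<Rightarrow> complex) set \<Rightarrow> 'g operator \<Rightarrow> bool"
  where "linear_between V W S \<longleftrightarrow> S \<in> V \<rightarrow> W \<and>
    (\<forall>f\<in>V. \<forall>g\<in>V. S (\<lambda>x. f x + g x) = (\<lambda>x. S f x + S g x)) \<and>
    (\<forall>c. \<forall>f\<in>V. S (\<lambda>x. c * f x) = (\<lambda>x. c * S f x))"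

definition endomorphisms :: "('g \<Rightarrow> complex) set \<Rightarrow> 'g operator set"
  where "endomorphisms V = {S \<in> extensional V. linear_between V V S}"

text \<open>A subalgebra is not required to contain the identity.  Adjoining the scalar operators to
  an abelian (inductive) subalgebra preserves these properties, so the maximal such subalgebras
  are the same with or without that requirement.  In finite dimension every subalgebra is weakly
  closed.\<close>

definition operator_subalgebra :: "('g \<Rightarrow> complex) set \<Rightarrow> 'g operator set \<Rightarrow> bool"
  where "operator_subalgebra V A \<longleftrightarrow> A \<subseteq> endomorphisms V \<and>
    (\<lambda>f\<in>V. \<lambda>x. 0) \<in> A \<and>
    (\<forall>S\<in>A. \<forall>R\<in>A. (\<lambda>f\<in>V. \<lambda>x. S f x + R f x) \<in> A) \<and>
    (\<forall>c. \<forall>S\<in>A. (\<lambda>f\<in>V. \<lambda>x. c * S f x) \<in> A) \<and>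
    (\<forall>S\<in>A. \<forall>R\<in>A. compose V S R \<in> A)"

definition abelian_subalgebra :: "('g \<Rightarrow> complex) set \<Rightarrow> 'g operator set \<Rightarrow> bool"
  where "abelian_subalgebra V A \<longleftrightarrow> operator_subalgebra V A \<and>
    (\<forall>S\<in>A. \<forall>R\<in>A. compose V S R = compose V R S)"

definition inductive_algebra :: "('g, 'm) monoid_scheme \<Rightarrow> ('g \<Rightarrow> complex) set \<Rightarrow>
    ('g \<Rightarrow> 'g operator) \<Rightarrow> 'g operator set \<Rightarrow> bool"
  where "inductive_algebra G V \<rho> A \<longleftrightarrow> abelian_subalgebra V A \<and>
    (\<forall>g\<in>carrier G. (\<lambda>S. \<lambda>f\<in>V. \<rho> g (S (inv_into V (\<rho> g) f))) ` A = A)"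

definition invariant_inner_product :: "('g, 'm) monoid_scheme \<Rightarrow> ('g \<Rightarrow> complex) set \<Rightarrow>
    ('g \<Rightarrow> 'g operator) \<Rightarrow> (('g \<Rightarrow> complex) \<Rightarrow> ('g \<Rightarrow> complex) \<Rightarrow> complex) \<Rightarrow> bool"
  where "invariant_inner_product G V \<rho> ip \<longleftrightarrow>
    (\<forall>f\<in>V. \<forall>g\<in>V. \<forall>h\<in>V. ip (\<lambda>x. f x + g x) h = ip f h + ip g h) \<and>
    (\<forall>c. \<forall>f\<in>V. \<forall>h\<in>V. ip (\<lambda>x. c * f x) h = c * ip f h) \<and>
    (\<forall>f\<in>V. \<forall>h\<in>V. ip h f = cnj (ip f h)) \<and>
    (\<forall>f\<in>V. f \<noteq> (\<lambda>x. 0) \<longrightarrow> 0 < Re (ip f f)) \<and>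
    (\<forall>g\<in>carrier G. \<forall>f\<in>V. \<forall>h\<in>V. ip (\<rho> g f) (\<rho> g h) = ip f h)"

definition self_adjoint_algebra :: "('g \<Rightarrow> complex) set \<Rightarrow>
    (('g \<Rightarrow> complex) \<Rightarrow> ('g \<Rightarrow> complex) \<Rightarrow> complex) \<Rightarrow> 'g operator set \<Rightarrow> bool"
  where "self_adjoint_algebra V ip A \<longleftrightarrow>
    (\<forall>S\<in>A. \<exists>R\<in>A. \<forall>f\<in>V. \<forall>h\<in>V. ip (S f) h = ip f (R h))"


section \<open>The canonical representation and the algebras of multiplication operators\<close>

text \<open>A function on the group \<open>G\<close> is encoded as a function vanishing outside \<open>carrier G\<close>.\<close>

definition induced_space :: "('g, 'm) monoid_scheme \<Rightarrow> ('g \<Rightarrow> 'k) \<Rightarrow> 'k set \<Rightarrow>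
    ('g \<Rightarrow> complex) \<Rightarrow> ('g \<Rightarrow> complex) set"
  where "induced_space G \<pi> M \<xi> =
    {f. (\<forall>x. x \<notin> carrier G \<longrightarrow> f x = 0) \<and>
        (\<forall>h\<in>ext_preimage G \<pi> M. \<forall>x\<in>carrier G. f (h \<otimes>\<^bsub>G\<^esub> x) = \<xi> h * f x)}"

definition induced_rep :: "('g, 'm) monoid_scheme \<Rightarrow> ('g \<Rightarrow> 'k) \<Rightarrow> 'k set \<Rightarrow>
    ('g \<Rightarrow> complex) \<Rightarrow> 'g \<Rightarrow> 'g operator"
  where "induced_rep G \<pi> M \<xi> g =
    (\<lambda>f\<in>induced_space G \<pi> M \<xi>. \<lambda>x. if x \<in> carrier G then f (x \<otimes>\<^bsub>G\<^esub> g) else 0)"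

definition rep_isomorphism :: "('g, 'm) monoid_scheme \<Rightarrow>
    ('g \<Rightarrow> complex) set \<Rightarrow> ('g \<Rightarrow> 'g operator) \<Rightarrow>
    ('g \<Rightarrow> complex) set \<Rightarrow> ('g \<Rightarrow> 'g operator) \<Rightarrow> 'g operator \<Rightarrow> bool"
  where "rep_isomorphism G V \<rho> W \<sigma> \<Phi> \<longleftrightarrow>
    linear_between V W \<Phi> \<and> bij_betw \<Phi> V W \<and>
    (\<forall>g\<in>carrier G. \<forall>f\<in>V. \<Phi> (\<rho> g f) = \<sigma> g (\<Phi> f))"

text \<open>The algebra \<open>\<A>(M)\<close>, first on the induced space itself and then transported to \<open>V\<close> along
  \<open>\<Phi>\<close>.\<close>

definition mult_algebra :: "('g, 'm) monoid_scheme \<Rightarrow> ('g \<Rightarrow> 'k) \<Rightarrow> 'k set \<Rightarrow>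
    ('g \<Rightarrow> complex) \<Rightarrow> 'g operator set"
  where "mult_algebra G \<pi> M \<xi> =
    {(\<lambda>f\<in>induced_space G \<pi> M \<xi>. \<lambda>x. u x * f x) | u.
       \<forall>h\<in>ext_preimage G \<pi> M. \<forall>x\<in>carrier G. u (h \<otimes>\<^bsub>G\<^esub> x) = u x}"

definition transported_mult_algebra :: "('g, 'm) monoid_scheme \<Rightarrow> ('g \<Rightarrow> 'k) \<Rightarrow>
    ('g \<Rightarrow> complex) set \<Rightarrow> 'k set \<Rightarrow> ('g \<Rightarrow> complex) \<Rightarrow> 'g operator \<Rightarrow> 'g operator set"
  where "transported_mult_algebra G \<pi> V M \<xi> \<Phi> =
    (\<lambda>m. \<lambda>f\<in>V. inv_into V \<Phi> (m (\<Phi> f))) ` mult_algebra G \<pi> M \<xi>"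

text \<open>\<open>A\<close> is the algebra \<open>\<A>(M)\<close> inside the endomorphisms of \<open>V\<close>: admissible choices of \<open>\<xi>\<close> and
  \<open>\<Phi>\<close> exist, and all of them yield \<open>A\<close>.\<close>

definition is_isotropic_algebra :: "('g, 'm) monoid_scheme \<Rightarrow> 'g topology \<Rightarrow>
    (complex \<Rightarrow> 'g) \<Rightarrow> ('g \<Rightarrow> 'k) \<Rightarrow> ('g \<Rightarrow> complex) set \<Rightarrow> ('g \<Rightarrow> 'g operator) \<Rightarrow>
    'k set \<Rightarrow> 'g operator set \<Rightarrow> bool"
  where "is_isotropic_algebra G X \<iota> \<pi> V \<rho> M A \<longleftrightarrow>
    (\<exists>\<xi>\<in>central_characters G X \<iota> \<pi> M. \<exists>\<Phi>.
       rep_isomorphism G V \<rho> (induced_space G \<pi> M \<xi>) (induced_rep G \<pi> M \<xi>) \<Phi>) \<and>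
    (\<forall>\<xi>\<in>central_characters G X \<iota> \<pi> M. \<forall>\<Phi>.
       rep_isomorphism G V \<rho> (induced_space G \<pi> M \<xi>) (induced_rep G \<pi> M \<xi>) \<Phi> \<longrightarrow>
       A = transported_mult_algebra G \<pi> V M \<xi> \<Phi>)"

end

theory Submission
  imports Defs "HOL-Algebra.Multiplicative_Group"
begin

text \<open>
  Conjugation by \<open>\<rho>\<close> makes \<open>End(V)\<close> a representation of \<open>G\<close> on which the centre acts trivially, that
  is, a representation of \<open>K\<close>.  If \<open>g\<close> lies over \<open>k\<close>, then \<open>\<rho> g\<close> spans a line on which \<open>K\<close> acts
  through the character \<open>e(-, k)\<close>.  By nondegeneracy of \<open>e\<close> these characters are distinct and
  exhaust the dual of \<open>K\<close>, and by Schur's lemma an operator transforming through \<open>e(-, k)\<close> is a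
  multiple of \<open>\<rho> g\<close>.  So \<open>End(V)\<close> is multiplicity-free (\<open>operator_expansion\<close>), and every conjugation
  invariant subalgebra is spanned by the operators \<open>\<rho> g\<close> that it contains.

  If the subalgebra is abelian, the elements of \<open>K\<close> underlying these operators annihilate each
  other under \<open>e\<close>, hence lie in a maximal isotropic subgroup \<open>N\<close>, and the subalgebra is contained in
  the commutant \<open>C(N)\<close> of all \<open>\<rho> h\<close> with \<open>h\<close> over \<open>N\<close> (\<open>inductive_algebra_in_commutant\<close>).  Since \<open>N\<close>
  is its own annihilator, \<open>C(N)\<close> is spanned by those same operators \<open>\<rho> h\<close>
  (\<open>commutant_expansion\<close>).  It is therefore abelian, its own commutant, invariant under conjugation,
  and self-adjoint because the adjoint of \<open>\<rho> h\<close> is \<open>\<rho> (inv h)\<close>.  A maximal inductive algebra thus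
  equals \<open>C(N)\<close>.

  It remains to identify \<open>C(N)\<close> with \<open>\<A>(N)\<close>.  In the model induced from \<open>N\<close> the elements over \<open>N\<close> act
  by multiplications, so their commutant there is the algebra of multiplication operators
  (\<open>mult_algebra_eq_commutant\<close>), and commutants are preserved by isomorphisms of representations.
  An isomorphism between the given model and one induced from \<open>N\<close> is built from a joint eigenvector
  of the elements over \<open>N\<close> in \<open>V\<close>: its eigenvalues are the inducing character, its matrix
  coefficients the isomorphism (\<open>eigencharacter\<close>, \<open>model_isomorphism\<close>).
\<close>

section \<open>The commutator form as a perfect alternating pairing\<close>

sublocale circle_extension \<subseteq> G: group G
  by (rule group_G)

sublocale circle_extension \<subseteq> K: comm_group K
  by (rule comm_group_K)

sublocale circle_extension \<subseteq> P: group_hom G K \<pi>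
  using pi_hom by unfold_locales

lemma carrier_circle_group: "carrier circle_group = {z. cmod z = 1}"
  by (auto simp: circle_group_def)

lemma mult_circle_group: "z \<otimes>\<^bsub>circle_group\<^esub> w = z * w"
  by (simp add: circle_group_def)

context circle_extension
begin

abbreviation lift_of :: "'k \<Rightarrow> 'g"
  where "lift_of \<equiv> inv_into (carrier G) \<pi>"

abbreviation pairing :: "'k \<Rightarrow> 'k \<Rightarrow> complex"
  where "pairing \<equiv> commutator_form G \<iota> \<pi>"

lemma lift_of_closed [simp]: "k \<in> carrier K \<Longrightarrow> lift_of k \<in> carrier G"
  using pi_surj by (metis inv_into_into)

lemma pi_lift_of [simp]: "k \<in> carrier K \<Longrightarrow> \<pi> (lift_of k) = k"
  using pi_surj by (metis f_inv_into_f)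

lemma iota_closed [simp]: "cmod z = 1 \<Longrightarrow> \<iota> z \<in> carrier G"
  using iota_hom by (auto simp: hom_def carrier_circle_group)

lemma iota_mult: "cmod z = 1 \<Longrightarrow> cmod w = 1 \<Longrightarrow> \<iota> (z * w) = \<iota> z \<otimes>\<^bsub>G\<^esub> \<iota> w"
  using iota_hom by (auto simp: hom_def carrier_circle_group mult_circle_group)

lemma iota_one [simp]: "\<iota> 1 = \<one>\<^bsub>G\<^esub>"
proof -
  have "\<iota> 1 \<otimes>\<^bsub>G\<^esub> \<iota> 1 = \<iota> 1" using iota_mult[of 1 1] by simp
  then show ?thesis by (metis G.l_cancel_one iota_closed norm_one)
qed

lemma iota_inverse: "cmod z = 1 \<Longrightarrow> inv\<^bsub>G\<^esub> (\<iota> z) = \<iota> (inverse z)"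
proof -
  assume z: "cmod z = 1"
  then have "z \<noteq> 0" by auto
  then have "\<iota> (inverse z) \<otimes>\<^bsub>G\<^esub> \<iota> z = \<one>\<^bsub>G\<^esub>"
    using z by (simp flip: iota_mult add: norm_inverse)
  then show ?thesis using z by (simp add: G.inv_equality norm_inverse)
qed

lemma iota_central: "cmod z = 1 \<Longrightarrow> x \<in> carrier G \<Longrightarrow> x \<otimes>\<^bsub>G\<^esub> \<iota> z = \<iota> z \<otimes>\<^bsub>G\<^esub> x"
  using central by (simp add: carrier_circle_group)

lemma pi_iota [simp]: "cmod z = 1 \<Longrightarrow> \<pi> (\<iota> z) = \<one>\<^bsub>K\<^esub>"
  using exact by (auto simp: kernel_def carrier_circle_group)

lemma iota_inj: "cmod z = 1 \<Longrightarrow> cmod w = 1 \<Longrightarrow> \<iota> z = \<iota> w \<Longrightarrow> z = w"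
proof -
  have "inj_on \<iota> (topspace circle_topology)"
    using iota_embedding homeomorphic_imp_injective_map unfolding embedding_map_def by blast
  then show "cmod z = 1 \<Longrightarrow> cmod w = 1 \<Longrightarrow> \<iota> z = \<iota> w \<Longrightarrow> z = w"
    by (auto simp: circle_topology_def inj_on_def)
qed

lemma same_fibre:
  assumes "x \<in> carrier G" "y \<in> carrier G" "\<pi> x = \<pi> y"
  obtains z where "cmod z = 1" "x = \<iota> z \<otimes>\<^bsub>G\<^esub> y"
proof -
  have "x \<otimes>\<^bsub>G\<^esub> inv\<^bsub>G\<^esub> y \<in> kernel G K \<pi>"
    using assms by (simp add: kernel_def)
  then obtain z where "cmod z = 1" "x \<otimes>\<^bsub>G\<^esub> inv\<^bsub>G\<^esub> y = \<iota> z"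
    using exact by (auto simp: carrier_circle_group)
  moreover then have "x = \<iota> z \<otimes>\<^bsub>G\<^esub> y"
    using assms by (metis G.inv_closed G.m_assoc G.l_inv G.r_one)
  ultimately show thesis using that by blast
qed

lemma norm_pairing [simp]: "k \<in> carrier K \<Longrightarrow> l \<in> carrier K \<Longrightarrow> cmod (pairing k l) = 1"
  using commutator_form_eq(1)[of "lift_of k" "lift_of l"] by (simp add: carrier_circle_group)

lemma pairing_cnj: "k \<in> carrier K \<Longrightarrow> l \<in> carrier K \<Longrightarrow> pairing k l * cnj (pairing k l) = 1"
  using complex_norm_square[of "pairing k l"] by simp

lemma mult_swap:
  assumes x: "x \<in> carrier G" and y: "y \<in> carrier G"
  shows "x \<otimes>\<^bsub>G\<^esub> y = \<iota> (pairing (\<pi> x) (\<pi> y)) \<otimes>\<^bsub>G\<^esub> (y \<otimes>\<^bsub>G\<^esub> x)"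
proof -
  have "inv\<^bsub>G\<^esub> y \<otimes>\<^bsub>G\<^esub> (y \<otimes>\<^bsub>G\<^esub> x) = x"
    using x y by (simp flip: G.m_assoc)
  then show ?thesis
    unfolding commutator_form_eq(2)[OF x y] using x y by (simp add: G.m_assoc)
qed

lemma pairing_self: assumes "k \<in> carrier K" shows "pairing k k = 1"
proof -
  let ?x = "lift_of k"
  have "\<iota> (pairing k k) = ?x \<otimes>\<^bsub>G\<^esub> ?x \<otimes>\<^bsub>G\<^esub> inv\<^bsub>G\<^esub> ?x \<otimes>\<^bsub>G\<^esub> inv\<^bsub>G\<^esub> ?x"
    using commutator_form_eq(2)[of ?x ?x] assms by simp
  also have "\<dots> = \<iota> 1" using assms by (simp add: G.m_assoc)
  finally show ?thesis using iota_inj[of "pairing k k" 1] assms by simp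
qed

end

context heisenberg_group
begin

text \<open>That the form is a homomorphism in each variable is part of the duality hypothesis: its
  values on one side are characters, and they depend on the other side homomorphically.\<close>

lemma pairing_mult_left:
  assumes "k \<in> carrier K" "k' \<in> carrier K" "l \<in> carrier K"
  shows "pairing (k \<otimes>\<^bsub>K\<^esub> k') l = pairing k l * pairing k' l"
proof -
  have "(\<lambda>k\<in>carrier K. pairing k l) \<in> unitary_characters K (discrete_topology (carrier K))"
    using duality assms(3) by (force simp: iso_def hom_def pontryagin_dual_def)
  then have "(\<lambda>k\<in>carrier K. pairing k l) \<in> hom K circle_group"
    by (auto simp: unitary_characters_def)
  from hom_mult[OF this assms(1,2)] show ?thesis
    using assms by (simp add: mult_circle_group)
qed

lemma pairing_mult_right:
  assumes "k \<in> carrier K" "l \<in> carrier K" "l' \<in> carrier K"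
  shows "pairing k (l \<otimes>\<^bsub>K\<^esub> l') = pairing k l * pairing k l'"
proof -
  have "(\<lambda>l\<in>carrier K. \<lambda>k\<in>carrier K. pairing k l)
          \<in> hom K (pontryagin_dual K (discrete_topology (carrier K)))"
    using duality by (simp add: iso_def)
  from fun_cong[OF hom_mult[OF this assms(2,3)], of k] show ?thesis
    using assms by (simp add: pontryagin_dual_def)
qed

lemma pairing_nonzero: "k \<in> carrier K \<Longrightarrow> l \<in> carrier K \<Longrightarrow> pairing k l \<noteq> 0"
  by (metis norm_pairing norm_zero zero_neq_one)

lemma pairing_one_left [simp]: "l \<in> carrier K \<Longrightarrow> pairing \<one>\<^bsub>K\<^esub> l = 1"
  using pairing_mult_left[of "\<one>\<^bsub>K\<^esub>" "\<one>\<^bsub>K\<^esub>" l] pairing_nonzero[of "\<one>\<^bsub>K\<^esub>" l] by simp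

lemma pairing_one_right [simp]: "k \<in> carrier K \<Longrightarrow> pairing k \<one>\<^bsub>K\<^esub> = 1"
  using pairing_mult_right[of k "\<one>\<^bsub>K\<^esub>" "\<one>\<^bsub>K\<^esub>"] pairing_nonzero[of k "\<one>\<^bsub>K\<^esub>"] by simp

lemma pairing_cnj_unique:
  assumes "k \<in> carrier K" "l \<in> carrier K" "pairing k l * z = 1"
  shows "z = cnj (pairing k l)"
  using assms pairing_cnj[OF assms(1,2)] pairing_nonzero[OF assms(1,2)]
  by (metis mult_left_cancel)

lemma pairing_swap:
  assumes "k \<in> carrier K" "l \<in> carrier K"
  shows "pairing l k = cnj (pairing k l)"
proof (rule pairing_cnj_unique[OF assms])
  show "pairing k l * pairing l k = 1"
    using assms pairing_self[of "k \<otimes>\<^bsub>K\<^esub> l"]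
    by (simp add: pairing_mult_left pairing_mult_right pairing_self[of k] pairing_self[of l] mult.commute)
qed

lemma pairing_inv_left:
  assumes "k \<in> carrier K" "l \<in> carrier K"
  shows "pairing (inv\<^bsub>K\<^esub> k) l = cnj (pairing k l)"
proof (rule pairing_cnj_unique[OF assms])
  show "pairing k l * pairing (inv\<^bsub>K\<^esub> k) l = 1"
    using assms by (simp flip: pairing_mult_left)
qed

lemma pairing_nondegenerate:
  assumes "l \<in> carrier K" "\<And>k. k \<in> carrier K \<Longrightarrow> pairing k l = 1"
  shows "l = \<one>\<^bsub>K\<^esub>"
proof -
  have "inj_on (\<lambda>l\<in>carrier K. \<lambda>k\<in>carrier K. pairing k l) (carrier K)"
    using duality by (simp add: iso_def bij_betw_def)
  from inj_onD[OF this, of l "\<one>\<^bsub>K\<^esub>"] show ?thesis using assms by fastforce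
qed

text \<open>Orthogonality of characters: translating the sum by an element of \<open>L\<close> on which the
  character is nontrivial multiplies the sum by a number other than 1.\<close>

lemma sum_pairing:
  assumes L: "subgroup L K" and l: "l \<in> carrier K"
  shows "(\<Sum>k\<in>L. pairing k l) = (if \<forall>k\<in>L. pairing k l = 1 then of_nat (card L) else 0)"
proof (cases "\<forall>k\<in>L. pairing k l = 1")
  case False
  then obtain a where a: "a \<in> L" "pairing a l \<noteq> 1" by auto
  have LK: "L \<subseteq> carrier K" using L by (rule subgroup.subset)
  have "bij_betw (\<lambda>k. a \<otimes>\<^bsub>K\<^esub> k) L L"
    by (rule bij_betw_byWitness[where f' = "\<lambda>k. inv\<^bsub>K\<^esub> a \<otimes>\<^bsub>K\<^esub> k"])
      (use a L LK in \<open>auto simp: subgroup.m_closed subgroup.m_inv_closed subset_iff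
          simp flip: K.m_assoc\<close>)
  then have "(\<Sum>k\<in>L. pairing k l) = (\<Sum>k\<in>L. pairing (a \<otimes>\<^bsub>K\<^esub> k) l)"
    by (rule sum.reindex_bij_betw[symmetric])
  also have "\<dots> = pairing a l * (\<Sum>k\<in>L. pairing k l)"
    using a l LK by (auto simp: sum_distrib_left pairing_mult_left subset_iff intro!: sum.cong)
  finally have "(1 - pairing a l) * (\<Sum>k\<in>L. pairing k l) = 0" by (simp add: algebra_simps)
  then show ?thesis using a False by auto
qed simp

lemma sum_pairing_carrier:
  assumes l: "l \<in> carrier K"
  shows "(\<Sum>k\<in>carrier K. pairing k l) = (if l = \<one>\<^bsub>K\<^esub> then of_nat (card (carrier K)) else 0)"
proof (cases "l = \<one>\<^bsub>K\<^esub>")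
  case False
  then have "\<not> (\<forall>k\<in>carrier K. pairing k l = 1)"
    using pairing_nondegenerate[OF l] by blast
  then show ?thesis
    using sum_pairing[OF K.subgroup_self l] False by (simp only: if_False)
qed (simp add: pairing_one_right)

section \<open>Maximal isotropic subgroups\<close>

definition annihilator
  where "annihilator N = {k \<in> carrier K. \<forall>n\<in>N. pairing k n = 1}"

lemma subgroup_annihilator: "N \<subseteq> carrier K \<Longrightarrow> subgroup (annihilator N) K"
  by (rule K.subgroupI)
    (auto simp: annihilator_def pairing_mult_left pairing_inv_left subset_iff
      intro!: exI[of _ "\<one>\<^bsub>K\<^esub>"])

text \<open>The double annihilator of a set on which the form is trivial is an isotropic subgroup:
  it annihilates the annihilator, which contains it.\<close>

lemma maximal_isotropic_above:
  assumes N: "N \<subseteq> carrier K" and triv: "\<And>k l. k \<in> N \<Longrightarrow> l \<in> N \<Longrightarrow> pairing k l = 1"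
  obtains M where "maximal_isotropic G K \<iota> \<pi> M" "N \<subseteq> M"
proof -
  let ?D = "annihilator (annihilator N)"
  have NA: "N \<subseteq> annihilator N" using N triv by (auto simp: annihilator_def)
  have AK: "annihilator N \<subseteq> carrier K" by (auto simp: annihilator_def)
  have D: "?D \<subseteq> annihilator N" using NA by (auto simp: annihilator_def)
  have ND: "N \<subseteq> ?D"
  proof
    fix n assume n: "n \<in> N"
    have "pairing n k = 1" if "k \<in> annihilator N" for k
      using pairing_swap[of k n] that n N by (auto simp: annihilator_def)
    then show "n \<in> ?D" using n N by (auto simp: annihilator_def[of "annihilator N"])
  qed
  have iso: "isotropic G K \<iota> \<pi> ?D"
    unfolding isotropic_def using subgroup_annihilator[OF AK] D
    by (auto simp: annihilator_def[of "annihilator N"])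
  let ?F = "{M. isotropic G K \<iota> \<pi> M \<and> N \<subseteq> M}"
  have "?F \<subseteq> Pow (carrier K)"
    by (auto simp: isotropic_def dest: subgroup.subset)
  then have "finite ?F" using finite_K by (meson finite_Pow_iff finite_subset)
  moreover have "?D \<in> ?F" using iso ND by auto
  ultimately obtain M where "M \<in> ?F" "\<forall>B\<in>?F. M \<subseteq> B \<longrightarrow> M = B"
    using finite_has_maximal2[of ?F ?D] by auto
  then have "maximal_isotropic G K \<iota> \<pi> M" "N \<subseteq> M"
    unfolding maximal_set_def by auto
  then show thesis by (rule that)
qed

lemma maximal_isotropicD:
  assumes "maximal_isotropic G K \<iota> \<pi> M"
  shows "subgroup M K" "M \<subseteq> carrier K" "finite M"
    and "\<And>k l. k \<in> M \<Longrightarrow> l \<in> M \<Longrightarrow> pairing k l = 1"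
proof -
  have iso: "isotropic G K \<iota> \<pi> M" using assms unfolding maximal_set_def by blast
  then show sub: "subgroup M K" by (simp add: isotropic_def)
  then show MK: "M \<subseteq> carrier K" by (rule subgroup.subset)
  then show "finite M" using finite_K by (rule finite_subset)
  show "\<And>k l. k \<in> M \<Longrightarrow> l \<in> M \<Longrightarrow> pairing k l = 1" using iso unfolding isotropic_def by blast
qed

text \<open>The form is alternating, so it stays trivial when an element annihilated by \<open>M\<close> is
  adjoined to \<open>M\<close>; by maximality that element already lies in \<open>M\<close>.\<close>

lemma maximal_isotropic_annihilator:
  assumes M: "maximal_isotropic G K \<iota> \<pi> M"
    and l: "l \<in> carrier K" and triv: "\<And>k. k \<in> M \<Longrightarrow> pairing k l = 1"
  shows "l \<in> M"
proof -
  note MK = maximal_isotropicD(2)[OF M]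
  have "pairing k k' = 1" if "k \<in> insert l M" "k' \<in> insert l M" for k k'
  proof -
    have "pairing l k = 1" if "k \<in> M" for k
      using pairing_swap[of k l] triv[OF that] l that MK by auto
    then show ?thesis using that maximal_isotropicD(4)[OF M] triv pairing_self[OF l] by auto
  qed
  then obtain M' where "maximal_isotropic G K \<iota> \<pi> M'" "insert l M \<subseteq> M'"
    using maximal_isotropic_above[of "insert l M"] l MK by auto
  then show ?thesis using M unfolding maximal_set_def by blast
qed

end

section \<open>Induced representations\<close>

context circle_extension
begin

text \<open>A function on \<open>G\<close> that is constant on the fibres of \<open>\<pi>\<close> is summed over \<open>K\<close> by
  means of lifts; such sums take the place of integrals over \<open>G\<close> modulo its centre.\<close>

lemma lift_of_pi:
  assumes inv: "\<And>z x. cmod z = 1 \<Longrightarrow> x \<in> carrier G \<Longrightarrow> \<phi> (\<iota> z \<otimes>\<^bsub>G\<^esub> x) = \<phi> x"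
    and x: "x \<in> carrier G"
  shows "\<phi> (lift_of (\<pi> x)) = \<phi> x"
proof -
  obtain z where "cmod z = 1" "x = \<iota> z \<otimes>\<^bsub>G\<^esub> lift_of (\<pi> x)"
    using x by (metis P.hom_closed lift_of_closed pi_lift_of same_fibre)
  then show ?thesis using inv x by (metis P.hom_closed lift_of_closed)
qed

lemma sum_lift_shift_right:
  assumes inv: "\<And>z x. cmod z = 1 \<Longrightarrow> x \<in> carrier G \<Longrightarrow> \<phi> (\<iota> z \<otimes>\<^bsub>G\<^esub> x) = \<phi> x"
    and a: "a \<in> carrier G"
  shows "(\<Sum>k\<in>carrier K. \<phi> (lift_of k \<otimes>\<^bsub>G\<^esub> a)) = (\<Sum>k\<in>carrier K. \<phi> (lift_of k))"
proof -
  have bij: "bij_betw (\<lambda>k. k \<otimes>\<^bsub>K\<^esub> \<pi> a) (carrier K) (carrier K)"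
    by (rule bij_betw_byWitness[where f' = "\<lambda>k. k \<otimes>\<^bsub>K\<^esub> inv\<^bsub>K\<^esub> \<pi> a"])
      (use a in \<open>auto simp: K.m_assoc\<close>)
  have "\<phi> (lift_of k \<otimes>\<^bsub>G\<^esub> a) = \<phi> (lift_of (k \<otimes>\<^bsub>K\<^esub> \<pi> a))" if "k \<in> carrier K" for k
    using lift_of_pi[of \<phi> "lift_of k \<otimes>\<^bsub>G\<^esub> a"] inv a that by simp
  then show ?thesis
    using sum.reindex_bij_betw[OF bij, of "\<lambda>k. \<phi> (lift_of k)"] by simp
qed

lemma sum_lift_shift_left:
  assumes inv: "\<And>z x. cmod z = 1 \<Longrightarrow> x \<in> carrier G \<Longrightarrow> \<phi> (\<iota> z \<otimes>\<^bsub>G\<^esub> x) = \<phi> x"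
    and a: "a \<in> carrier G"
  shows "(\<Sum>k\<in>carrier K. \<phi> (a \<otimes>\<^bsub>G\<^esub> lift_of k)) = (\<Sum>k\<in>carrier K. \<phi> (lift_of k))"
proof -
  have bij: "bij_betw (\<lambda>k. \<pi> a \<otimes>\<^bsub>K\<^esub> k) (carrier K) (carrier K)"
    by (rule bij_betw_byWitness[where f' = "\<lambda>k. inv\<^bsub>K\<^esub> \<pi> a \<otimes>\<^bsub>K\<^esub> k"])
      (use a in \<open>auto simp flip: K.m_assoc\<close>)
  have "\<phi> (a \<otimes>\<^bsub>G\<^esub> lift_of k) = \<phi> (lift_of (\<pi> a \<otimes>\<^bsub>K\<^esub> k))" if "k \<in> carrier K" for k
    using lift_of_pi[of \<phi> "a \<otimes>\<^bsub>G\<^esub> lift_of k"] inv a that by simp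
  then show ?thesis
    using sum.reindex_bij_betw[OF bij, of "\<lambda>k. \<phi> (lift_of k)"] by simp
qed

end

lemma (in heisenberg_group) pairing_inv_right:
  assumes "k \<in> carrier K" "l \<in> carrier K"
  shows "pairing k (inv\<^bsub>K\<^esub> l) = cnj (pairing k l)"
  using assms pairing_swap[of "inv\<^bsub>K\<^esub> l" k] pairing_swap[of l k] pairing_inv_left[of l k] by simp

locale induced_model =
  heisenberg_group G X K \<iota> \<pi>
  for G :: "('g, 'm) monoid_scheme" and X :: "'g topology"
    and K :: "('k, 'n) monoid_scheme" and \<iota> :: "complex \<Rightarrow> 'g" and \<pi> :: "'g \<Rightarrow> 'k" +
  fixes M :: "'k set" and \<xi> :: "'g \<Rightarrow> complex"
  assumes max_M: "maximal_isotropic G K \<iota> \<pi> M"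
    and central_xi: "\<xi> \<in> central_characters G X \<iota> \<pi> M"
begin

abbreviation H :: "'g set" where "H \<equiv> ext_preimage G \<pi> M"
abbreviation V :: "('g \<Rightarrow> complex) set" where "V \<equiv> induced_space G \<pi> M \<xi>"
abbreviation \<rho> :: "'g \<Rightarrow> 'g operator" where "\<rho> \<equiv> induced_rep G \<pi> M \<xi>"

lemma subgroup_M: "subgroup M K"
  by (rule maximal_isotropicD(1)[OF max_M])

lemma M_closed: "m \<in> M \<Longrightarrow> m \<in> carrier K"
  using subgroup_M by (rule subgroup.mem_carrier)

lemma finite_M: "finite M"
  by (rule maximal_isotropicD(3)[OF max_M])

lemma card_M: "card M \<noteq> 0"
  using finite_M subgroup.one_closed[OF subgroup_M] by auto

lemma pairing_M: "k \<in> M \<Longrightarrow> l \<in> M \<Longrightarrow> pairing k l = 1"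
  by (rule maximal_isotropicD(4)[OF max_M])

lemma H_iff: "h \<in> H \<longleftrightarrow> h \<in> carrier G \<and> \<pi> h \<in> M"
  by (simp add: ext_preimage_def)

lemma H_closed: "h \<in> H \<Longrightarrow> h \<in> carrier G"
  by (simp add: H_iff)

lemma lift_of_H: "m \<in> M \<Longrightarrow> lift_of m \<in> H"
  using M_closed by (simp add: H_iff)

lemma iota_H: "cmod z = 1 \<Longrightarrow> \<iota> z \<in> H"
  using subgroup.one_closed[OF subgroup_M] by (simp add: H_iff)

lemma H_mult: "h \<in> H \<Longrightarrow> h' \<in> H \<Longrightarrow> h \<otimes>\<^bsub>G\<^esub> h' \<in> H"
  using subgroup.m_closed[OF subgroup_M] by (simp add: H_iff)

lemma one_H: "\<one>\<^bsub>G\<^esub> \<in> H"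
  using subgroup.one_closed[OF subgroup_M] by (simp add: H_iff)

lemma H_mult_iff:
  assumes h: "h \<in> H" and x: "x \<in> carrier G"
  shows "h \<otimes>\<^bsub>G\<^esub> x \<in> H \<longleftrightarrow> x \<in> H"
proof
  assume "h \<otimes>\<^bsub>G\<^esub> x \<in> H"
  then have "inv\<^bsub>K\<^esub> \<pi> h \<otimes>\<^bsub>K\<^esub> (\<pi> h \<otimes>\<^bsub>K\<^esub> \<pi> x) \<in> M"
    using h x subgroup_M by (intro subgroup.m_closed[OF subgroup_M, of "inv\<^bsub>K\<^esub> \<pi> h"])
      (auto simp: H_iff subgroup.m_inv_closed)
  then show "x \<in> H" using h x by (simp add: H_iff flip: K.m_assoc)
qed (use h H_mult in auto)

lemma norm_xi: "h \<in> H \<Longrightarrow> cmod (\<xi> h) = 1"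
  using central_xi
  by (auto simp: central_characters_def unitary_characters_def hom_def carrier_circle_group)

lemma xi_cnj: "h \<in> H \<Longrightarrow> cnj (\<xi> h) * \<xi> h = 1"
  using complex_norm_square[of "\<xi> h"] norm_xi by (simp add: mult.commute)

lemma xi_mult: "h \<in> H \<Longrightarrow> h' \<in> H \<Longrightarrow> \<xi> (h \<otimes>\<^bsub>G\<^esub> h') = \<xi> h * \<xi> h'"
  using central_xi
  by (auto simp: central_characters_def unitary_characters_def hom_def mult_circle_group)

lemma xi_iota: "cmod z = 1 \<Longrightarrow> \<xi> (\<iota> z) = z"
  using central_xi by (simp add: central_characters_def carrier_circle_group)

lemma xi_one: "\<xi> \<one>\<^bsub>G\<^esub> = 1"
  using xi_iota[of 1] by simp

lemma VI:
  assumes "\<And>x. x \<notin> carrier G \<Longrightarrow> f x = 0"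
    and "\<And>h x. h \<in> H \<Longrightarrow> x \<in> carrier G \<Longrightarrow> f (h \<otimes>\<^bsub>G\<^esub> x) = \<xi> h * f x"
  shows "f \<in> V"
  using assms by (simp add: induced_space_def)

lemma V_outside: "f \<in> V \<Longrightarrow> x \<notin> carrier G \<Longrightarrow> f x = 0"
  by (simp add: induced_space_def)

lemma V_left: "f \<in> V \<Longrightarrow> h \<in> H \<Longrightarrow> x \<in> carrier G \<Longrightarrow> f (h \<otimes>\<^bsub>G\<^esub> x) = \<xi> h * f x"
  by (simp add: induced_space_def)

lemma V_iota: "f \<in> V \<Longrightarrow> cmod z = 1 \<Longrightarrow> x \<in> carrier G \<Longrightarrow> f (\<iota> z \<otimes>\<^bsub>G\<^esub> x) = z * f x"
  by (simp add: V_left iota_H xi_iota)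

lemma V_right:
  assumes "f \<in> V" "h \<in> H" "x \<in> carrier G"
  shows "f (x \<otimes>\<^bsub>G\<^esub> h) = pairing (\<pi> x) (\<pi> h) * \<xi> h * f x"
  using assms mult_swap[of x h] by (simp add: V_iota V_left H_closed)

lemma V_zero: "(\<lambda>x. 0) \<in> V"
  by (rule VI) auto

lemma V_add: "f \<in> V \<Longrightarrow> g \<in> V \<Longrightarrow> (\<lambda>x. f x + g x) \<in> V"
  by (rule VI) (auto simp: V_outside V_left algebra_simps)

lemma V_scale: "f \<in> V \<Longrightarrow> (\<lambda>x. c * f x) \<in> V"
  by (rule VI) (auto simp: V_outside V_left)

lemma V_sum: "(\<And>i. i \<in> I \<Longrightarrow> f i \<in> V) \<Longrightarrow> (\<lambda>x. \<Sum>i\<in>I. c i * f i x) \<in> V"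
  by (rule VI) (auto simp: V_outside V_left sum_distrib_left algebra_simps intro!: sum.cong sum.neutral)

lemma operator_scale: "linear_between V W S \<Longrightarrow> f \<in> V \<Longrightarrow> S (\<lambda>x. c * f x) = (\<lambda>x. c * S f x)"
  by (simp add: linear_between_def)

lemma operator_add: "linear_between V W S \<Longrightarrow> f \<in> V \<Longrightarrow> g \<in> V \<Longrightarrow>
    S (\<lambda>x. f x + g x) = (\<lambda>x. S f x + S g x)"
  by (simp add: linear_between_def)

lemma operator_zero: "linear_between V W S \<Longrightarrow> S (\<lambda>x. 0) = (\<lambda>x. 0)"
  using operator_scale[OF _ V_zero, of W S 0] by simp

lemma operator_sum:
  assumes S: "linear_between V W S" and "finite I" and "\<And>i. i \<in> I \<Longrightarrow> f i \<in> V"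
  shows "S (\<lambda>x. \<Sum>i\<in>I. c i * f i x) = (\<lambda>x. \<Sum>i\<in>I. c i * S (f i) x)"
  using assms(2,3)
proof (induction I rule: finite_induct)
  case empty
  then show ?case using operator_zero[OF S] by simp
next
  case (insert j I)
  have "S (\<lambda>x. c j * f j x + (\<Sum>i\<in>I. c i * f i x)) =
      (\<lambda>x. S (\<lambda>x. c j * f j x) x + S (\<lambda>x. \<Sum>i\<in>I. c i * f i x) x)"
    by (rule operator_add[OF S V_scale V_sum]) (use insert.prems in auto)
  then show ?case using insert operator_scale[OF S] by simp
qed

lemma rho_apply: "f \<in> V \<Longrightarrow> \<rho> g f x = (if x \<in> carrier G then f (x \<otimes>\<^bsub>G\<^esub> g) else 0)"
  by (simp add: induced_rep_def)

lemma rho_closed: "f \<in> V \<Longrightarrow> g \<in> carrier G \<Longrightarrow> \<rho> g f \<in> V"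
  by (rule VI) (auto simp: rho_apply G.m_assoc V_left H_closed)

lemma rho_mult: "f \<in> V \<Longrightarrow> g \<in> carrier G \<Longrightarrow> h \<in> carrier G \<Longrightarrow> \<rho> g (\<rho> h f) = \<rho> (g \<otimes>\<^bsub>G\<^esub> h) f"
  by (rule ext) (auto simp: rho_apply rho_closed G.m_assoc)

lemma rho_one: "f \<in> V \<Longrightarrow> \<rho> \<one>\<^bsub>G\<^esub> f = f"
  by (rule ext) (auto simp: rho_apply V_outside)

lemma rho_iota: "f \<in> V \<Longrightarrow> cmod z = 1 \<Longrightarrow> \<rho> (\<iota> z) f = (\<lambda>x. z * f x)"
  by (rule ext) (auto simp: rho_apply V_outside iota_central V_iota)

lemma linear_rho: "g \<in> carrier G \<Longrightarrow> linear_between V V (\<rho> g)"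
  unfolding linear_between_def by (auto simp: rho_closed rho_apply V_add V_scale fun_eq_iff)

lemma rho_endomorphism: "g \<in> carrier G \<Longrightarrow> \<rho> g \<in> endomorphisms V"
  using linear_rho by (simp add: endomorphisms_def induced_rep_def)

lemma rho_inverse:
  assumes "f \<in> V" "g \<in> carrier G"
  shows "\<rho> g (\<rho> (inv\<^bsub>G\<^esub> g) f) = f" "\<rho> (inv\<^bsub>G\<^esub> g) (\<rho> g f) = f"
  using assms by (simp_all add: rho_mult rho_one)

lemma inv_into_rho:
  assumes "f \<in> V" "g \<in> carrier G"
  shows "inv_into V (\<rho> g) f = \<rho> (inv\<^bsub>G\<^esub> g) f"
proof (rule inv_into_f_eq)
  show "inj_on (\<rho> g) V" by (rule inj_on_inverseI[where g = "\<rho> (inv\<^bsub>G\<^esub> g)"]) (simp add: rho_inverse assms(2))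
qed (use assms in \<open>simp_all add: rho_closed rho_inverse\<close>)

section \<open>Schur's lemma and the isotypic decomposition of operators\<close>

text \<open>By \<open>V_right\<close>, \<open>h \<in> H\<close> acts as multiplication by \<open>\<xi> h\<close> times the function
  \<open>x \<mapsto> pairing (\<pi> x) (\<pi> h)\<close>.  After division by \<open>\<xi> h\<close>, averaging over \<open>M\<close> gives the indicator
  function of the annihilator of \<open>M\<close>, which is \<open>M\<close>.\<close>

lemma restrict_to_H:
  assumes f: "f \<in> V"
  shows "(\<lambda>x. if x \<in> H then f x else 0) =
    (\<lambda>x. \<Sum>m\<in>M. (cnj (\<xi> (lift_of m)) / of_nat (card M)) * \<rho> (lift_of m) f x)"
proof
  fix x
  show "(if x \<in> H then f x else 0) =
    (\<Sum>m\<in>M. (cnj (\<xi> (lift_of m)) / of_nat (card M)) * \<rho> (lift_of m) f x)"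
  proof (cases "x \<in> carrier G")
    case True
    have "(cnj (\<xi> (lift_of m)) / of_nat (card M)) * \<rho> (lift_of m) f x =
        cnj (pairing m (\<pi> x)) * (f x / of_nat (card M))" if "m \<in> M" for m
      using True f that xi_cnj[OF lift_of_H[OF that]] pairing_swap[of m "\<pi> x"]
      by (simp add: rho_apply V_right lift_of_H M_closed algebra_simps)
    then have "(\<Sum>m\<in>M. (cnj (\<xi> (lift_of m)) / of_nat (card M)) * \<rho> (lift_of m) f x) =
        (\<Sum>m\<in>M. cnj (pairing m (\<pi> x)) * (f x / of_nat (card M)))"
      by (rule sum.cong[OF refl])
    also have "\<dots> = cnj (\<Sum>m\<in>M. pairing m (\<pi> x)) * (f x / of_nat (card M))"
      by (simp add: sum_distrib_right sum_divide_distrib)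
    finally have "(\<Sum>m\<in>M. (cnj (\<xi> (lift_of m)) / of_nat (card M)) * \<rho> (lift_of m) f x) =
        cnj (\<Sum>m\<in>M. pairing m (\<pi> x)) * (f x / of_nat (card M))" .
    moreover have "(\<forall>m\<in>M. pairing m (\<pi> x) = 1) \<longleftrightarrow> x \<in> H"
      using True maximal_isotropic_annihilator[OF max_M, of "\<pi> x"] pairing_M
      by (auto simp: H_iff)
    ultimately show ?thesis
      using sum_pairing[OF subgroup_M, of "\<pi> x"] True card_M by auto
  qed (auto simp: H_iff rho_apply f)
qed

definition \<delta> :: "'g \<Rightarrow> complex"
  where "\<delta> x = (if x \<in> H then \<xi> x else 0)"

lemma delta_closed: "\<delta> \<in> V"
  by (rule VI) (auto simp: \<delta>_def H_mult_iff xi_mult H_closed)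

lemma delta_one: "\<delta> \<one>\<^bsub>G\<^esub> = 1"
  by (simp add: \<delta>_def one_H xi_one)

text \<open>An operator commuting with \<open>G\<close> commutes with restriction to \<open>H\<close>, so it maps
  \<open>\<delta>\<close> to a multiple \<open>c\<close> of itself.  Hence it multiplies the value at the
  identity by \<open>c\<close>, and by translation every other value too.\<close>

lemma schur:
  assumes T: "linear_between V V T"
    and comm: "\<And>g f. g \<in> carrier G \<Longrightarrow> f \<in> V \<Longrightarrow> T (\<rho> g f) = \<rho> g (T f)"
  obtains c where "\<And>f. f \<in> V \<Longrightarrow> T f = (\<lambda>x. c * f x)"
proof
  have TV: "T f \<in> V" if "f \<in> V" for f using T that by (auto simp: linear_between_def)
  have at_one: "T f \<one>\<^bsub>G\<^esub> = T \<delta> \<one>\<^bsub>G\<^esub> * f \<one>\<^bsub>G\<^esub>" if f: "f \<in> V" for f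
  proof -
    have 1: "(\<lambda>x. if x \<in> H then f x else 0) = (\<lambda>x. f \<one>\<^bsub>G\<^esub> * \<delta> x)"
    proof
      fix x show "(if x \<in> H then f x else 0) = f \<one>\<^bsub>G\<^esub> * \<delta> x"
        using V_left[OF f, of x "\<one>\<^bsub>G\<^esub>"] by (auto simp: \<delta>_def H_closed)
    qed
    have "T (\<lambda>x. if x \<in> H then f x else 0) = (\<lambda>x. if x \<in> H then T f x else 0)"
      unfolding restrict_to_H[OF f] restrict_to_H[OF TV[OF f]]
      using f by (subst operator_sum[OF T finite_M]) (auto simp: rho_closed M_closed comm)
    from fun_cong[OF this, of "\<one>\<^bsub>G\<^esub>"] show ?thesis
      unfolding 1 operator_scale[OF T delta_closed] by (simp add: one_H mult.commute)
  qed
  fix f assume f: "f \<in> V"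
  show "T f = (\<lambda>x. T \<delta> \<one>\<^bsub>G\<^esub> * f x)"
  proof
    fix x
    show "T f x = T \<delta> \<one>\<^bsub>G\<^esub> * f x"
    proof (cases "x \<in> carrier G")
      case True
      then show ?thesis
        using at_one[OF rho_closed[OF f True]] comm[OF True f] by (simp add: rho_apply TV f)
    qed (simp add: V_outside TV f)
  qed
qed

text \<open>The component of \<open>S\<close> on which \<open>G\<close> acts by conjugation through the character
  \<open>\<lambda>g. pairing (\<pi> g) k\<close>.\<close>

definition isotypic :: "'k \<Rightarrow> 'g operator \<Rightarrow> 'g operator"
  where "isotypic k S = (\<lambda>f\<in>V. \<lambda>x. \<Sum>l\<in>carrier K.
    (cnj (pairing l k) / of_nat (card (carrier K))) *
      \<rho> (lift_of l) (S (\<rho> (inv\<^bsub>G\<^esub> (lift_of l)) f)) x)"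

lemma endomorphism_linear: "S \<in> endomorphisms V \<Longrightarrow> linear_between V V S"
  by (simp add: endomorphisms_def)

lemma endomorphism_closed: "S \<in> endomorphisms V \<Longrightarrow> f \<in> V \<Longrightarrow> S f \<in> V"
  by (auto simp: endomorphisms_def linear_between_def)

lemma isotypic_closed:
  assumes "S \<in> endomorphisms V" "f \<in> V"
  shows "isotypic k S f \<in> V"
  unfolding isotypic_def restrict_apply'[OF assms(2)]
  by (rule V_sum) (use assms in \<open>simp add: rho_closed endomorphism_closed\<close>)

lemma linear_isotypic:
  assumes S: "S \<in> endomorphisms V"
  shows "linear_between V V (isotypic k S)"
proof -
  have lin: "S (\<lambda>x. f x + g x) = (\<lambda>x. S f x + S g x)" "S (\<lambda>x. c * f x) = (\<lambda>x. c * S f x)"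
    if "f \<in> V" "g \<in> V" for f g c
    using endomorphism_linear[OF S] that by (auto simp: linear_between_def)
  have rho: "\<rho> a (\<lambda>x. f x + g x) = (\<lambda>x. \<rho> a f x + \<rho> a g x)"
      "\<rho> a (\<lambda>x. c * f x) = (\<lambda>x. c * \<rho> a f x)"
    if "f \<in> V" "g \<in> V" "a \<in> carrier G" for f g a c
    using linear_rho that by (auto simp: linear_between_def)
  show ?thesis
    unfolding linear_between_def
    by (auto simp: isotypic_closed[OF S])
      (auto simp: isotypic_def lin rho rho_closed endomorphism_closed[OF S] V_add V_scale
        sum_distrib_left algebra_simps sum.distrib add_divide_distrib intro!: sum.cong)
qed

text \<open>The conjugates \<open>\<rho> y S (\<rho> y)\<^sup>-\<^sup>1\<close> depend on \<open>y\<close> only modulo the centre, so the sum over \<open>K\<close>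
  may be translated by \<open>g\<close>, which pulls out a value of the character.\<close>

lemma isotypic_conjugate:
  assumes S: "S \<in> endomorphisms V" and f: "f \<in> V" and g: "g \<in> carrier G" and k: "k \<in> carrier K"
  shows "isotypic k S (\<rho> g f) = (\<lambda>x. cnj (pairing (\<pi> g) k) * \<rho> g (isotypic k S f) x)"
proof
  fix x
  let ?n = "of_nat (card (carrier K)) :: complex"
  show "isotypic k S (\<rho> g f) x = cnj (pairing (\<pi> g) k) * \<rho> g (isotypic k S f) x"
  proof (cases "x \<in> carrier G")
    case True
    define \<phi> where "\<phi> y = (cnj (pairing (\<pi> g) k) * cnj (pairing (\<pi> y) k) / ?n) *
      S (\<rho> (inv\<^bsub>G\<^esub> y) f) (x \<otimes>\<^bsub>G\<^esub> g \<otimes>\<^bsub>G\<^esub> y)" for y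
    have \<phi>: "\<phi> (\<iota> z \<otimes>\<^bsub>G\<^esub> y) = \<phi> y" if z: "cmod z = 1" and y: "y \<in> carrier G" for z y
    proof -
      have z0: "z \<noteq> 0" "cmod (inverse z) = 1" using z by (auto simp: norm_inverse)
      let ?f = "\<rho> (inv\<^bsub>G\<^esub> y) f"
      have fV: "?f \<in> V" "S ?f \<in> V" using f y by (auto simp: rho_closed endomorphism_closed[OF S])
      have "\<rho> (inv\<^bsub>G\<^esub> (\<iota> z \<otimes>\<^bsub>G\<^esub> y)) f = (\<lambda>x. inverse z * ?f x)"
        using f z y z0 fV
        by (simp add: G.inv_mult_group iota_inverse iota_central rho_iota flip: rho_mult)
      moreover have "S (\<lambda>x. inverse z * ?f x) = (\<lambda>x. inverse z * S ?f x)"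
        by (rule operator_scale[OF endomorphism_linear[OF S] fV(1)])
      moreover have "S ?f (x \<otimes>\<^bsub>G\<^esub> g \<otimes>\<^bsub>G\<^esub> (\<iota> z \<otimes>\<^bsub>G\<^esub> y)) = z * S ?f (x \<otimes>\<^bsub>G\<^esub> g \<otimes>\<^bsub>G\<^esub> y)"
      proof -
        have "x \<otimes>\<^bsub>G\<^esub> g \<otimes>\<^bsub>G\<^esub> (\<iota> z \<otimes>\<^bsub>G\<^esub> y) = \<iota> z \<otimes>\<^bsub>G\<^esub> (x \<otimes>\<^bsub>G\<^esub> g \<otimes>\<^bsub>G\<^esub> y)"
          using True g z y by (simp add: iota_central flip: G.m_assoc)
        then show ?thesis using V_iota[OF fV(2) z] True g y by simp
      qed
      ultimately show ?thesis using z y z0 by (simp add: \<phi>_def)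
    qed
    have "x \<otimes>\<^bsub>G\<^esub> g \<otimes>\<^bsub>G\<^esub> inv\<^bsub>G\<^esub> g = x"
      using True g by (simp add: G.m_assoc)
    then have "isotypic k S (\<rho> g f) x = (\<Sum>l\<in>carrier K. \<phi> (inv\<^bsub>G\<^esub> g \<otimes>\<^bsub>G\<^esub> lift_of l))"
      unfolding isotypic_def using f g k True pairing_cnj[of "\<pi> g" k]
      by (auto simp: \<phi>_def rho_closed rho_apply[of "S _"] endomorphism_closed[OF S] rho_mult
            G.inv_mult_group pairing_mult_left pairing_inv_left G.m_assoc[symmetric]
            mult.commute mult.left_commute intro!: sum.cong)
    also have "\<dots> = (\<Sum>l\<in>carrier K. \<phi> (lift_of l))"
      by (rule sum_lift_shift_left[OF \<phi>]) (use g in auto)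
    also have "\<dots> = cnj (pairing (\<pi> g) k) * \<rho> g (isotypic k S f) x"
      using True f g
      by (auto simp: rho_apply[OF isotypic_closed[OF S f]])
        (auto simp: isotypic_def \<phi>_def rho_apply[of "S _"] endomorphism_closed[OF S] rho_closed
          sum_distrib_left G.m_assoc intro!: sum.cong)
    finally show ?thesis .
  qed (use f g in \<open>simp add: V_outside isotypic_closed[OF S] rho_closed\<close>)
qed

text \<open>The operator \<open>\<rho> (lift_of k)\<close> transforms in the same way, so the two differ by an operator
  commuting with \<open>G\<close>, that is, by a scalar.\<close>

lemma isotypic_scalar:
  assumes S: "S \<in> endomorphisms V" and k: "k \<in> carrier K"
  obtains c where "\<And>f. f \<in> V \<Longrightarrow> isotypic k S f = (\<lambda>x. c * \<rho> (lift_of k) f x)"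
proof -
  let ?a = "inv\<^bsub>G\<^esub> (lift_of k)"
  define T where "T f = \<rho> ?a (isotypic k S f)" for f
  have a: "?a \<in> carrier G" using k by simp
  have lin: "linear_between V V T"
    using linear_rho[OF a] linear_isotypic[OF S, of k] unfolding linear_between_def T_def
    by (auto simp: Pi_iff)
  have "T (\<rho> g f) = \<rho> g (T f)" if g: "g \<in> carrier G" and f: "f \<in> V" for g f
  proof -
    let ?P = "isotypic k S f"
    have P: "?P \<in> V" by (rule isotypic_closed[OF S f])
    have "\<rho> g (T f) = \<rho> (g \<otimes>\<^bsub>G\<^esub> ?a) ?P"
      using P a g by (simp add: T_def rho_mult)
    also have "g \<otimes>\<^bsub>G\<^esub> ?a = \<iota> (cnj (pairing (\<pi> g) k)) \<otimes>\<^bsub>G\<^esub> (?a \<otimes>\<^bsub>G\<^esub> g)"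
      using mult_swap[OF g a] g k by (simp add: pairing_inv_right)
    also have "\<rho> \<dots> ?P = (\<lambda>x. cnj (pairing (\<pi> g) k) * \<rho> (?a \<otimes>\<^bsub>G\<^esub> g) ?P x)"
      using P a g k by (simp add: rho_iota rho_closed flip: rho_mult[of ?P "\<iota> _"])
    also have "\<dots> = \<rho> ?a (\<lambda>x. cnj (pairing (\<pi> g) k) * \<rho> g ?P x)"
      using P a g by (simp add: operator_scale[OF linear_rho[OF a]] rho_closed rho_mult)
    also have "\<dots> = T (\<rho> g f)"
      unfolding T_def isotypic_conjugate[OF S f g k] ..
    finally show ?thesis ..
  qed
  then obtain c where c: "\<And>f. f \<in> V \<Longrightarrow> T f = (\<lambda>x. c * f x)"
    using schur[OF lin] by blast
  have "isotypic k S f = (\<lambda>x. c * \<rho> (lift_of k) f x)" if f: "f \<in> V" for f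
  proof -
    have "isotypic k S f = \<rho> (lift_of k) (T f)"
      using rho_inverse(1)[OF isotypic_closed[OF S f], of "lift_of k" k] k by (simp add: T_def)
    then show ?thesis using k f by (simp add: c operator_scale[OF linear_rho])
  qed
  then show thesis by (rule that)
qed

text \<open>Fourier inversion on \<open>K\<close>: by nondegeneracy the sum over all characters isolates the term of
  the trivial element, and central elements cancel in a conjugation.\<close>

lemma sum_isotypic:
  assumes S: "S \<in> endomorphisms V" and f: "f \<in> V"
  shows "S f x = (\<Sum>k\<in>carrier K. isotypic k S f x)"
proof -
  let ?n = "of_nat (card (carrier K)) :: complex"
  let ?t = "\<lambda>l. \<rho> (lift_of l) (S (\<rho> (inv\<^bsub>G\<^esub> (lift_of l)) f)) x"
  have n: "?n \<noteq> 0" using finite_K K.one_closed by auto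
  have "(\<Sum>k\<in>carrier K. isotypic k S f x) =
      (\<Sum>k\<in>carrier K. \<Sum>l\<in>carrier K. (cnj (pairing l k) / ?n) * ?t l)"
    using f by (simp add: isotypic_def)
  also have "\<dots> = (\<Sum>l\<in>carrier K. (\<Sum>k\<in>carrier K. cnj (pairing l k)) * (?t l / ?n))"
    by (subst sum.swap) (simp add: sum_distrib_right sum_divide_distrib)
  also have "\<dots> = (\<Sum>l\<in>carrier K. (\<Sum>k\<in>carrier K. pairing k l) * (?t l / ?n))"
    by (intro sum.cong arg_cong2[of _ _ _ _ "(*)"] pairing_swap[symmetric] refl)
  also have "\<dots> = (\<Sum>l\<in>carrier K. if l = \<one>\<^bsub>K\<^esub> then ?t l else 0)"
    using n by (intro sum.cong) (auto simp: sum_pairing_carrier)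
  also have "\<dots> = ?t \<one>\<^bsub>K\<^esub>"
    using finite_K by simp
  also have "\<dots> = S f x"
  proof -
    obtain z where z: "cmod z = 1" "lift_of \<one>\<^bsub>K\<^esub> = \<iota> z \<otimes>\<^bsub>G\<^esub> \<one>\<^bsub>G\<^esub>"
      by (rule same_fibre[of "lift_of \<one>\<^bsub>K\<^esub>" "\<one>\<^bsub>G\<^esub>"]) (auto intro: that)
    then have lift: "lift_of \<one>\<^bsub>K\<^esub> = \<iota> z" by simp
    have z0: "z \<noteq> 0" "cmod (inverse z) = 1" using z by (auto simp: norm_inverse)
    have Sf: "S f \<in> V" by (rule endomorphism_closed[OF S f])
    have "\<rho> (inv\<^bsub>G\<^esub> (\<iota> z)) f = (\<lambda>x. inverse z * f x)"
      unfolding iota_inverse[OF z(1)] by (rule rho_iota[OF f z0(2)])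
    then have "S (\<rho> (inv\<^bsub>G\<^esub> (\<iota> z)) f) = (\<lambda>x. inverse z * S f x)"
      by (simp only: operator_scale[OF endomorphism_linear[OF S] f])
    then show ?thesis
      unfolding lift by (simp only: rho_iota[OF V_scale[OF Sf] z(1)]) (simp add: z0)
  qed
  finally show ?thesis ..
qed

text \<open>The conjugation action of \<open>K\<close> on the endomorphisms is multiplicity-free, with one line, spanned
  by \<open>\<rho> (lift_of k)\<close>, for each character \<open>\<lambda>l. pairing l k\<close>.\<close>

lemma operator_expansion:
  assumes S: "S \<in> endomorphisms V"
  obtains c where "\<forall>f\<in>V. S f = (\<lambda>x. \<Sum>k\<in>carrier K. c k * \<rho> (lift_of k) f x)"
    and "\<forall>k\<in>carrier K. \<forall>f\<in>V. isotypic k S f = (\<lambda>x. c k * \<rho> (lift_of k) f x)"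
proof -
  have "\<exists>c. \<forall>f\<in>V. isotypic k S f = (\<lambda>x. c * \<rho> (lift_of k) f x)" if "k \<in> carrier K" for k
    using isotypic_scalar[OF S that] by metis
  then obtain c where c: "\<forall>k\<in>carrier K. \<forall>f\<in>V. isotypic k S f = (\<lambda>x. c k * \<rho> (lift_of k) f x)"
    by metis
  have "S f = (\<lambda>x. \<Sum>k\<in>carrier K. c k * \<rho> (lift_of k) f x)" if f: "f \<in> V" for f
    using sum_isotypic[OF S f] by (intro ext) (simp add: c f)
  then show thesis using c that by blast
qed

section \<open>Commutants of isotropic subgroups\<close>

definition commutant :: "'k set \<Rightarrow> 'g operator set"
  where "commutant N = {S \<in> endomorphisms V.
    \<forall>h\<in>ext_preimage G \<pi> N. \<forall>f\<in>V. S (\<rho> h f) = \<rho> h (S f)}"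

lemma rho_swap:
  assumes "f \<in> V" "a \<in> carrier G" "b \<in> carrier G"
  shows "\<rho> a (\<rho> b f) = (\<lambda>x. pairing (\<pi> a) (\<pi> b) * \<rho> b (\<rho> a f) x)"
proof -
  have "\<rho> a (\<rho> b f) = \<rho> (\<iota> (pairing (\<pi> a) (\<pi> b)) \<otimes>\<^bsub>G\<^esub> (b \<otimes>\<^bsub>G\<^esub> a)) f"
    using assms mult_swap[of a b] by (simp add: rho_mult)
  also have "\<dots> = \<rho> (\<iota> (pairing (\<pi> a) (\<pi> b))) (\<rho> (b \<otimes>\<^bsub>G\<^esub> a) f)"
    using assms by (intro rho_mult[symmetric]) auto
  also have "\<dots> = (\<lambda>x. pairing (\<pi> a) (\<pi> b) * \<rho> b (\<rho> a f) x)"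
    unfolding rho_iota[OF rho_closed[OF assms(1) G.m_closed[OF assms(3,2)]]
        norm_pairing[OF P.hom_closed[OF assms(2)] P.hom_closed[OF assms(3)]]]
    by (simp add: rho_mult assms)
  finally show ?thesis .
qed

text \<open>Conjugation by a lift of \<open>n\<close> multiplies the \<open>k\<close>-th coefficient by \<open>pairing n k\<close>.  It fixes
  \<open>S\<close>, so averaging over \<open>N\<close> leaves only coefficients indexed by the annihilator of \<open>N\<close>,
  which is \<open>N\<close> itself.\<close>

lemma commutant_expansion:
  assumes N: "maximal_isotropic G K \<iota> \<pi> N" and S: "S \<in> commutant N"
  obtains c where "\<And>f. f \<in> V \<Longrightarrow> S f = (\<lambda>x. \<Sum>k\<in>N. c k * \<rho> (lift_of k) f x)"
proof -
  have SE: "S \<in> endomorphisms V" using S by (simp add: commutant_def)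
  obtain c where "\<forall>f\<in>V. S f = (\<lambda>x. \<Sum>k\<in>carrier K. c k * \<rho> (lift_of k) f x)"
    by (rule operator_expansion[OF SE])
  then have c: "\<And>f. f \<in> V \<Longrightarrow> S f = (\<lambda>x. \<Sum>k\<in>carrier K. c k * \<rho> (lift_of k) f x)"
    by (rule bspec)
  note iso = maximal_isotropicD(1,4)[OF N] and finN = maximal_isotropicD(3)[OF N]
  have NK: "n \<in> carrier K" if "n \<in> N" for n
    using maximal_isotropicD(2)[OF N] that by blast
  have cardN: "card N \<noteq> 0" using finN subgroup.one_closed[OF iso(1)] by auto
  have "S f x = (\<Sum>k\<in>N. c k * \<rho> (lift_of k) f x)" if f: "f \<in> V" for f x
  proof -
    have conj: "S f x = (\<Sum>k\<in>carrier K. pairing n k * (c k * \<rho> (lift_of k) f x))" if n: "n \<in> N" for n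
    proof -
      let ?a = "lift_of n"
      have a: "?a \<in> carrier G" "?a \<in> ext_preimage G \<pi> N" "\<pi> ?a = n"
        using NK[OF n] n by (auto simp: ext_preimage_def)
      let ?f = "\<rho> (inv\<^bsub>G\<^esub> ?a) f"
      have fV: "?f \<in> V" using f a by (simp add: rho_closed)
      have "S f = S (\<rho> ?a ?f)" using f a by (simp add: rho_inverse)
      also have "\<dots> = \<rho> ?a (S ?f)" using S fV a by (simp add: commutant_def)
      also have "\<dots> = (\<lambda>x. \<Sum>k\<in>carrier K. c k * \<rho> ?a (\<rho> (lift_of k) ?f) x)"
        unfolding c[OF fV] using fV a
        by (intro operator_sum[OF linear_rho finite_K]) (auto simp: rho_closed)
      also have "\<dots> = (\<lambda>x. \<Sum>k\<in>carrier K. pairing n k * (c k * \<rho> (lift_of k) f x))"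
        using fV a f by (intro ext sum.cong) (auto simp: rho_swap[of ?f ?a] rho_inverse)
      finally show ?thesis by simp
    qed
    have "of_nat (card N) * S f x = (\<Sum>n\<in>N. S f x)" by simp
    also have "\<dots> = (\<Sum>n\<in>N. \<Sum>k\<in>carrier K. pairing n k * (c k * \<rho> (lift_of k) f x))"
      using conj by (rule sum.cong[OF refl])
    also have "\<dots> = (\<Sum>k\<in>carrier K. (\<Sum>n\<in>N. pairing n k) * (c k * \<rho> (lift_of k) f x))"
      by (subst sum.swap) (simp add: sum_distrib_right)
    also have "\<dots> = (\<Sum>k\<in>carrier K. if k \<in> N then of_nat (card N) * (c k * \<rho> (lift_of k) f x) else 0)"
    proof (rule sum.cong[OF refl])
      fix k assume k: "k \<in> carrier K"
      have "(\<forall>n\<in>N. pairing n k = 1) \<longleftrightarrow> k \<in> N"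
        using maximal_isotropic_annihilator[OF N k] iso(2) by blast
      then show "(\<Sum>n\<in>N. pairing n k) * (c k * \<rho> (lift_of k) f x) =
          (if k \<in> N then of_nat (card N) * (c k * \<rho> (lift_of k) f x) else 0)"
        unfolding sum_pairing[OF iso(1) k] by simp
    qed
    also have "\<dots> = (\<Sum>k\<in>N. of_nat (card N) * (c k * \<rho> (lift_of k) f x))"
      using finite_K NK by (subst sum.inter_restrict[symmetric]) (auto intro!: sum.cong)
    finally show ?thesis using cardN by (simp flip: sum_distrib_left)
  qed
  then show thesis by (intro that) auto
qed

lemma subalgebra_sum:
  assumes A: "operator_subalgebra V A" and "finite I" and "\<And>i. i \<in> I \<Longrightarrow> T i \<in> A"
  shows "(\<lambda>f\<in>V. \<lambda>x. \<Sum>i\<in>I. c i * T i f x) \<in> A"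
  using assms(2,3)
proof (induction I rule: finite_induct)
  case empty
  then show ?case using A by (simp only: operator_subalgebra_def sum.empty)
next
  case (insert j I)
  let ?R = "\<lambda>f\<in>V. \<lambda>x. c j * T j f x" and ?S = "\<lambda>f\<in>V. \<lambda>x. \<Sum>i\<in>I. c i * T i f x"
  have "?R \<in> A"
    using A insert.prems[of j] unfolding operator_subalgebra_def by blast
  moreover have "?S \<in> A"
    by (rule insert.IH) (use insert.prems in blast)
  ultimately have mem: "(\<lambda>f\<in>V. \<lambda>x. ?R f x + ?S f x) \<in> A"
    using A unfolding operator_subalgebra_def by blast
  have eq: "(\<lambda>f\<in>V. \<lambda>x. ?R f x + ?S f x) = (\<lambda>f\<in>V. \<lambda>x. \<Sum>i\<in>insert j I. c i * T i f x)"
    using insert.hyps by (intro restrict_ext) simp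
  show ?case using mem unfolding eq .
qed

lemma operator_eqI:
  assumes "S \<in> endomorphisms V" "R \<in> endomorphisms V" "\<And>f. f \<in> V \<Longrightarrow> S f = R f"
  shows "S = R"
  using assms by (intro extensionalityI[of S V R]) (auto simp: endomorphisms_def)

lemma endomorphismI:
  assumes "linear_between V V S"
  shows "(\<lambda>f\<in>V. S f) \<in> endomorphisms V"
  using assms V_add V_scale unfolding endomorphisms_def linear_between_def by (auto simp: Pi_iff)

lemma conjugate_eq:
  assumes "g \<in> carrier G"
  shows "(\<lambda>f\<in>V. \<rho> g (S (inv_into V (\<rho> g) f))) = (\<lambda>f\<in>V. \<rho> g (S (\<rho> (inv\<^bsub>G\<^esub> g) f)))"
  using assms by (intro restrict_ext) (simp add: inv_into_rho)

lemma isotypic_in_inductive_algebra: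
  assumes A: "inductive_algebra G V \<rho> A" and S: "S \<in> A"
  shows "isotypic k S \<in> A"
proof -
  have sub: "operator_subalgebra V A"
    using A by (simp add: inductive_algebra_def abelian_subalgebra_def)
  define T where "T l = (\<lambda>f\<in>V. \<rho> (lift_of l) (S (\<rho> (inv\<^bsub>G\<^esub> (lift_of l)) f)))" for l
  have "T l \<in> A" if "l \<in> carrier K" for l
  proof -
    have g: "lift_of l \<in> carrier G" using that by simp
    then have "(\<lambda>S. \<lambda>f\<in>V. \<rho> (lift_of l) (S (inv_into V (\<rho> (lift_of l)) f))) ` A = A"
      using A by (simp add: inductive_algebra_def)
    then show ?thesis using S unfolding T_def conjugate_eq[OF g, symmetric] by blast
  qed
  then have "(\<lambda>f\<in>V. \<lambda>x. \<Sum>l\<in>carrier K.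
      (cnj (pairing l k) / of_nat (card (carrier K))) * T l f x) \<in> A"
    by (rule subalgebra_sum[OF sub finite_K])
  also have "(\<lambda>f\<in>V. \<lambda>x. \<Sum>l\<in>carrier K.
      (cnj (pairing l k) / of_nat (card (carrier K))) * T l f x) = isotypic k S"
    unfolding isotypic_def by (intro restrict_ext) (simp add: T_def)
  finally show ?thesis .
qed

text \<open>Since \<open>\<rho>\<close> is faithful on the centre, commuting operators come from commuting elements.\<close>

lemma pairing_trivial_if_commute:
  assumes "a \<in> carrier G" "b \<in> carrier G"
    and comm: "\<And>f. f \<in> V \<Longrightarrow> \<rho> a (\<rho> b f) = \<rho> b (\<rho> a f)"
  shows "pairing (\<pi> a) (\<pi> b) = 1"
proof -
  let ?f = "\<rho> (inv\<^bsub>G\<^esub> (b \<otimes>\<^bsub>G\<^esub> a)) \<delta>"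
  have f: "?f \<in> V" using assms delta_closed by (simp add: rho_closed)
  have "\<rho> b (\<rho> a ?f) = \<delta>"
    unfolding rho_mult[OF f assms(2,1)] using assms(1,2) by (simp add: rho_inverse(1)[OF delta_closed])
  then have "pairing (\<pi> a) (\<pi> b) * \<delta> \<one>\<^bsub>G\<^esub> = \<delta> \<one>\<^bsub>G\<^esub>"
    using fun_cong[OF rho_swap[OF f assms(1,2)], of "\<one>\<^bsub>G\<^esub>"] comm[OF f] by simp
  then show ?thesis by (simp add: delta_one)
qed

text \<open>An inductive algebra is invariant under conjugation by \<open>G\<close>, hence contains the isotypic
  components of its elements.  It is therefore spanned by the operators \<open>\<rho> (lift_of k)\<close> in
  it; these commute, so the pairing is trivial on their indices.\<close>

lemma inductive_algebra_in_commutant: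
  assumes A: "inductive_algebra G V \<rho> A"
  obtains N where "maximal_isotropic G K \<iota> \<pi> N" "A \<subseteq> commutant N"
proof -
  have sub: "operator_subalgebra V A"
    using A by (simp add: inductive_algebra_def abelian_subalgebra_def)
  then have AE: "A \<subseteq> endomorphisms V" by (simp add: operator_subalgebra_def)
  define N0 where "N0 = {k \<in> carrier K. \<rho> (lift_of k) \<in> A}"
  have "pairing k l = 1" if "k \<in> N0" "l \<in> N0" for k l
  proof -
    have kl: "k \<in> carrier K" "l \<in> carrier K" using that by (auto simp: N0_def)
    have "compose V (\<rho> (lift_of k)) (\<rho> (lift_of l)) = compose V (\<rho> (lift_of l)) (\<rho> (lift_of k))"
      using A that by (simp add: N0_def inductive_algebra_def abelian_subalgebra_def)
    note eq = fun_cong[OF this]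
    have "\<rho> (lift_of k) (\<rho> (lift_of l) f) = \<rho> (lift_of l) (\<rho> (lift_of k) f)" if "f \<in> V" for f
      using eq[of f] that by (simp add: compose_def)
    from pairing_trivial_if_commute[OF _ _ this] show ?thesis using kl by simp
  qed
  then obtain N where N: "maximal_isotropic G K \<iota> \<pi> N" "N0 \<subseteq> N"
    using maximal_isotropic_above[of N0] by (auto simp: N0_def)
  note iso = maximal_isotropicD(4)[OF N(1)]
  have "S \<in> commutant N" if S: "S \<in> A" for S
  proof -
    have SE: "S \<in> endomorphisms V" using S AE by auto
    obtain c where c0: "\<forall>f\<in>V. S f = (\<lambda>x. \<Sum>k\<in>carrier K. c k * \<rho> (lift_of k) f x)"
      "\<forall>k\<in>carrier K. \<forall>f\<in>V. isotypic k S f = (\<lambda>x. c k * \<rho> (lift_of k) f x)"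
      by (rule operator_expansion[OF SE])
    note c = bspec[OF c0(1)] bspec[OF bspec[OF c0(2)]]
    have supp: "k \<in> N" if k: "k \<in> carrier K" and ck: "c k \<noteq> 0" for k
    proof -
      have "(\<lambda>f\<in>V. \<lambda>x. inverse (c k) * isotypic k S f x) \<in> A"
        using sub isotypic_in_inductive_algebra[OF A S] by (simp only: operator_subalgebra_def)
      also have "(\<lambda>f\<in>V. \<lambda>x. inverse (c k) * isotypic k S f x) = (\<lambda>f\<in>V. \<rho> (lift_of k) f)"
        by (intro restrict_ext) (simp add: c(2) k ck flip: mult.assoc)
      also have "\<dots> = \<rho> (lift_of k)"
        by (rule extensionalityI[of _ V]) (auto simp: induced_rep_def)
      finally show ?thesis using k N by (auto simp: N0_def)
    qed
    have "S (\<rho> h f) = \<rho> h (S f)" if h: "h \<in> ext_preimage G \<pi> N" and f: "f \<in> V" for h f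
    proof -
      have hG: "h \<in> carrier G" "\<pi> h \<in> N" using h by (auto simp: ext_preimage_def)
      have "\<rho> h (S f) = (\<lambda>x. \<Sum>k\<in>carrier K. c k * \<rho> h (\<rho> (lift_of k) f) x)"
        unfolding c(1)[OF f] using f hG
        by (intro operator_sum[OF linear_rho finite_K]) (auto simp: rho_closed)
      also have "\<dots> = (\<lambda>x. \<Sum>k\<in>carrier K. c k * \<rho> (lift_of k) (\<rho> h f) x)"
        using f hG supp iso by (intro ext sum.cong) (auto simp: rho_swap[of f h])
      also have "\<dots> = S (\<rho> h f)" using f hG by (simp add: c(1) rho_closed)
      finally show ?thesis ..
    qed
    then show ?thesis using SE by (simp add: commutant_def)
  qed
  then show thesis using that N(1) by blast
qed

lemma commutantD:
  assumes "S \<in> commutant N"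
  shows "S \<in> endomorphisms V"
    and "\<And>h f. h \<in> ext_preimage G \<pi> N \<Longrightarrow> f \<in> V \<Longrightarrow> S (\<rho> h f) = \<rho> h (S f)"
  using assms by (auto simp: commutant_def)

lemma commutant_restrictI:
  assumes lin: "linear_between V V S"
    and comm: "\<And>h f. h \<in> ext_preimage G \<pi> N \<Longrightarrow> f \<in> V \<Longrightarrow> S (\<rho> h f) = \<rho> h (S f)"
  shows "(\<lambda>f\<in>V. S f) \<in> commutant N"
  unfolding commutant_def using endomorphismI[OF lin] comm
  by (auto simp: rho_closed ext_preimage_def)

lemma commutant_subalgebra: "operator_subalgebra V (commutant N)"
proof -
  have pre: "h \<in> carrier G" if "h \<in> ext_preimage G \<pi> N" for h
    using that by (simp add: ext_preimage_def)
  have zero: "(\<lambda>f\<in>V. \<lambda>x. 0) \<in> commutant N"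
    by (rule commutant_restrictI)
      (auto simp: linear_between_def V_zero operator_zero[OF linear_rho] pre)
  have add: "(\<lambda>f\<in>V. \<lambda>x. S f x + R f x) \<in> commutant N"
    if S: "S \<in> commutant N" and R: "R \<in> commutant N" for S R
  proof (rule commutant_restrictI)
    show "linear_between V V (\<lambda>f x. S f x + R f x)"
      using commutantD(1)[OF S] commutantD(1)[OF R]
      by (auto simp: endomorphisms_def linear_between_def V_add algebra_simps Pi_iff)
    show "(\<lambda>x. S (\<rho> h f) x + R (\<rho> h f) x) = \<rho> h (\<lambda>x. S f x + R f x)"
      if "h \<in> ext_preimage G \<pi> N" "f \<in> V" for h f
      using that S R
      by (simp add: commutantD(2) operator_add[OF linear_rho] pre endomorphism_closed commutantD(1))
  qed
  have scale: "(\<lambda>f\<in>V. \<lambda>x. c * S f x) \<in> commutant N" if S: "S \<in> commutant N" for S c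
  proof (rule commutant_restrictI)
    show "linear_between V V (\<lambda>f x. c * S f x)"
      using commutantD(1)[OF S]
      by (auto simp: endomorphisms_def linear_between_def V_scale algebra_simps Pi_iff)
    show "(\<lambda>x. c * S (\<rho> h f) x) = \<rho> h (\<lambda>x. c * S f x)"
      if "h \<in> ext_preimage G \<pi> N" "f \<in> V" for h f
      using that S
      by (simp add: commutantD(2) operator_scale[OF linear_rho] pre endomorphism_closed commutantD(1))
  qed
  have comp: "compose V S R \<in> commutant N"
    if S: "S \<in> commutant N" and R: "R \<in> commutant N" for S R
    unfolding compose_def
  proof (rule commutant_restrictI)
    show "linear_between V V (\<lambda>f. S (R f))"
      using commutantD(1)[OF S] commutantD(1)[OF R]
      by (auto simp: endomorphisms_def linear_between_def Pi_iff)
    show "S (R (\<rho> h f)) = \<rho> h (S (R f))" if "h \<in> ext_preimage G \<pi> N" "f \<in> V" for h f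
      using that S R by (simp add: commutantD(2) endomorphism_closed commutantD(1))
  qed
  show ?thesis
    unfolding operator_subalgebra_def using zero add scale comp by (auto simp: commutant_def)
qed

text \<open>One factor is a combination of operators \<open>\<rho> (lift_of k)\<close> with \<open>k \<in> N\<close>, with which the other
  factor commutes by definition.\<close>

lemma commutant_abelian:
  assumes N: "maximal_isotropic G K \<iota> \<pi> N"
  shows "abelian_subalgebra V (commutant N)"
proof -
  have "compose V S R = compose V R S" if S: "S \<in> commutant N" and R: "R \<in> commutant N" for S R
    unfolding compose_def
  proof (rule restrict_ext)
    fix f assume f: "f \<in> V"
    obtain c where c: "\<And>f. f \<in> V \<Longrightarrow> R f = (\<lambda>x. \<Sum>k\<in>N. c k * \<rho> (lift_of k) f x)"
      using commutant_expansion[OF N R] by blast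
    note finN = maximal_isotropicD(3)[OF N]
    have NK: "k \<in> carrier K" if "k \<in> N" for k
      using maximal_isotropicD(2)[OF N] that by blast
    note SE = commutantD(1)[OF S]
    have "S (R f) = (\<lambda>x. \<Sum>k\<in>N. c k * S (\<rho> (lift_of k) f) x)"
      unfolding c[OF f] using f NK
      by (intro operator_sum[OF endomorphism_linear[OF SE] finN]) (auto simp: rho_closed)
    also have "\<dots> = (\<lambda>x. \<Sum>k\<in>N. c k * \<rho> (lift_of k) (S f) x)"
      using f NK by (intro ext sum.cong) (auto simp: commutantD(2)[OF S] ext_preimage_def)
    also have "\<dots> = R (S f)" by (simp add: c endomorphism_closed[OF SE f])
    finally show "S (R f) = R (S f)" .
  qed
  then show ?thesis using commutant_subalgebra by (simp add: abelian_subalgebra_def)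
qed

text \<open>The preimage of \<open>N\<close> is normal because \<open>K\<close> is abelian.\<close>

lemma conjugate_in_commutant:
  assumes N: "N \<subseteq> carrier K" and S: "S \<in> commutant N" and g: "g \<in> carrier G"
  shows "(\<lambda>f\<in>V. \<rho> g (S (\<rho> (inv\<^bsub>G\<^esub> g) f))) \<in> commutant N"
proof (rule commutant_restrictI)
  note SE = commutantD(1)[OF S]
  show "linear_between V V (\<lambda>f. \<rho> g (S (\<rho> (inv\<^bsub>G\<^esub> g) f)))"
    using endomorphism_linear[OF SE] linear_rho[OF g] linear_rho[OF G.inv_closed[OF g]]
    unfolding linear_between_def by (simp add: Pi_iff)
  fix h f assume h: "h \<in> ext_preimage G \<pi> N" and f: "f \<in> V"
  let ?g = "inv\<^bsub>G\<^esub> g" and ?h = "inv\<^bsub>G\<^esub> g \<otimes>\<^bsub>G\<^esub> h \<otimes>\<^bsub>G\<^esub> g"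
  have hG: "h \<in> carrier G" "\<pi> h \<in> N" using h by (auto simp: ext_preimage_def)
  have "\<pi> ?h = \<pi> h"
    using hG g by (simp add: K.m_comm[of "inv\<^bsub>K\<^esub> \<pi> g"] K.m_assoc)
  then have h': "?h \<in> ext_preimage G \<pi> N" using hG g by (simp add: ext_preimage_def)
  have "\<rho> ?g (\<rho> h f) = \<rho> ?h (\<rho> ?g f)"
    using hG g f by (simp add: rho_mult G.m_assoc)
  then have "\<rho> g (S (\<rho> ?g (\<rho> h f))) = \<rho> g (\<rho> ?h (S (\<rho> ?g f)))"
    using commutantD(2)[OF S h'] f g by (simp add: rho_closed)
  also have "\<dots> = \<rho> h (\<rho> g (S (\<rho> ?g f)))"
    using hG g f by (simp add: rho_mult endomorphism_closed[OF SE] rho_closed flip: G.m_assoc)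
  finally show "\<rho> g (S (\<rho> ?g (\<rho> h f))) = \<rho> h (\<rho> g (S (\<rho> ?g f)))" .
qed

lemma commutant_inductive:
  assumes N: "maximal_isotropic G K \<iota> \<pi> N"
  shows "inductive_algebra G V \<rho> (commutant N)"
proof -
  note NK = maximal_isotropicD(2)[OF N]
  have "(\<lambda>S. \<lambda>f\<in>V. \<rho> g (S (inv_into V (\<rho> g) f))) ` commutant N = commutant N"
    if g: "g \<in> carrier G" for g
    unfolding conjugate_eq[OF g]
  proof (intro equalityI subsetI)
    fix S assume S: "S \<in> commutant N"
    let ?R = "\<lambda>f\<in>V. \<rho> (inv\<^bsub>G\<^esub> g) (S (\<rho> g f))"
    have R: "?R \<in> commutant N"
      using conjugate_in_commutant[OF NK S, of "inv\<^bsub>G\<^esub> g"] g by simp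
    have "S = (\<lambda>f\<in>V. \<rho> g (?R (\<rho> (inv\<^bsub>G\<^esub> g) f)))"
      using g commutantD(1)[OF S] conjugate_in_commutant[OF NK R g]
      by (intro operator_eqI) (auto simp: commutantD(1) rho_closed rho_inverse endomorphism_closed)
    then show "S \<in> (\<lambda>S. \<lambda>f\<in>V. \<rho> g (S (\<rho> (inv\<^bsub>G\<^esub> g) f))) ` commutant N"
      using R by blast
  qed (use conjugate_in_commutant[OF NK _ g] in blast)
  then show ?thesis using commutant_abelian[OF N] by (simp add: inductive_algebra_def)
qed

lemma rho_in_commutant:
  assumes N: "maximal_isotropic G K \<iota> \<pi> N" and g: "g \<in> ext_preimage G \<pi> N"
  shows "\<rho> g \<in> commutant N"
proof -
  have "\<rho> g (\<rho> h f) = \<rho> h (\<rho> g f)" if "h \<in> ext_preimage G \<pi> N" "f \<in> V" for h f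
    using that g rho_swap[of f g h] maximal_isotropicD(4)[OF N] by (auto simp: ext_preimage_def)
  then show ?thesis using rho_endomorphism[of g] g by (simp add: commutant_def ext_preimage_def)
qed

text \<open>The commutant contains the operators that define it, so everything that commutes with it
  lies in it.\<close>

lemma commutant_maximal_abelian:
  assumes N: "maximal_isotropic G K \<iota> \<pi> N"
  shows "maximal_set (abelian_subalgebra V) (commutant N)"
  unfolding maximal_set_def
proof (intro conjI allI impI)
  fix B assume B: "abelian_subalgebra V B \<and> commutant N \<subseteq> B"
  have "R \<in> commutant N" if R: "R \<in> B" for R
  proof -
    have "R (\<rho> h f) = \<rho> h (R f)" if h: "h \<in> ext_preimage G \<pi> N" and f: "f \<in> V" for h f
    proof -
      have "compose V R (\<rho> h) = compose V (\<rho> h) R"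
        using B R rho_in_commutant[OF N h] by (auto simp: abelian_subalgebra_def)
      then show ?thesis using f by (metis compose_eq)
    qed
    moreover have "R \<in> endomorphisms V"
      using B R by (auto simp: abelian_subalgebra_def operator_subalgebra_def)
    ultimately show ?thesis by (simp add: commutant_def)
  qed
  then show "B = commutant N" using B by blast
qed (rule commutant_abelian[OF N])

text \<open>In the model attached to \<open>M\<close> the group \<open>H\<close> acts by multiplication operators, so the
  expansion of an element of the commutant exhibits it as one.\<close>

lemma mult_algebra_eq_commutant: "mult_algebra G \<pi> M \<xi> = commutant M"
proof (intro equalityI subsetI)
  fix S assume "S \<in> mult_algebra G \<pi> M \<xi>"
  then obtain u where u: "\<And>h x. h \<in> H \<Longrightarrow> x \<in> carrier G \<Longrightarrow> u (h \<otimes>\<^bsub>G\<^esub> x) = u x"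
    and S: "S = (\<lambda>f\<in>V. \<lambda>x. u x * f x)"
    by (auto simp: mult_algebra_def)
  show "S \<in> commutant M"
    unfolding S
  proof (rule commutant_restrictI)
    have "(\<lambda>x. u x * f x) \<in> V" if "f \<in> V" for f
      using that by (intro VI) (auto simp: V_outside V_left u)
    then show "linear_between V V (\<lambda>f x. u x * f x)"
      by (auto simp: linear_between_def algebra_simps)
    fix h f assume h: "h \<in> H" and f: "f \<in> V"
    have "u (x \<otimes>\<^bsub>G\<^esub> h) = u x" if x: "x \<in> carrier G" for x
      using h x u[of h x] u[of "\<iota> (pairing (\<pi> x) (\<pi> h))" "h \<otimes>\<^bsub>G\<^esub> x"] mult_swap[OF x H_closed[OF h]]
      by (simp add: iota_H H_closed)
    then show "(\<lambda>x. u x * \<rho> h f x) = \<rho> h (\<lambda>x. u x * f x)"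
      using f \<open>\<And>f. f \<in> V \<Longrightarrow> (\<lambda>x. u x * f x) \<in> V\<close> by (auto simp: rho_apply fun_eq_iff)
  qed
next
  fix S assume S: "S \<in> commutant M"
  obtain c where c: "\<And>f. f \<in> V \<Longrightarrow> S f = (\<lambda>x. \<Sum>k\<in>M. c k * \<rho> (lift_of k) f x)"
    using commutant_expansion[OF max_M S] by blast
  define u where "u x = (\<Sum>k\<in>M. c k * (pairing (\<pi> x) k * \<xi> (lift_of k)))" for x
  have "u (h \<otimes>\<^bsub>G\<^esub> x) = u x" if "h \<in> H" "x \<in> carrier G" for h x
    unfolding u_def using that
    by (intro sum.cong) (auto simp: H_iff pairing_mult_left M_closed pairing_M)
  moreover have "S = (\<lambda>f\<in>V. \<lambda>x. u x * f x)"
  proof (rule extensionalityI[of _ V])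
    fix f assume f: "f \<in> V"
    have "S f x = u x * f x" for x
    proof (cases "x \<in> carrier G")
      case True
      then show ?thesis using f unfolding c[OF f] u_def sum_distrib_right
        by (intro sum.cong) (auto simp: rho_apply V_right lift_of_H M_closed)
    qed (use f in \<open>simp add: c rho_apply V_outside\<close>)
    then show "S f = (\<lambda>f\<in>V. \<lambda>x. u x * f x) f" using f by auto
  qed (use commutantD(1)[OF S] in \<open>auto simp: endomorphisms_def\<close>)
  ultimately show "S \<in> mult_algebra G \<pi> M \<xi>" unfolding mult_algebra_def by blast
qed

text \<open>With respect to an invariant inner product, \<open>\<rho> (inv g)\<close> is the adjoint of \<open>\<rho> g\<close>, so
  adjoints are computed term by term.\<close>

lemma commutant_self_adjoint:
  assumes N: "maximal_isotropic G K \<iota> \<pi> N" and ip: "invariant_inner_product G V \<rho> ip"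
  shows "self_adjoint_algebra V ip (commutant N)"
  unfolding self_adjoint_algebra_def
proof
  have add: "ip (\<lambda>x. f x + g x) h = ip f h + ip g h" and scale: "ip (\<lambda>x. c * f x) h = c * ip f h"
    and herm: "ip h f = cnj (ip f h)"
    if "f \<in> V" "g \<in> V" "h \<in> V" for f g h c
    using ip that unfolding invariant_inner_product_def by blast+
  have inv: "ip (\<rho> g f) (\<rho> g h) = ip f h" if "g \<in> carrier G" "f \<in> V" "h \<in> V" for g f h
    using ip that unfolding invariant_inner_product_def by blast
  have ip_sum: "ip (\<lambda>x. \<Sum>i\<in>I. c i * f i x) h = (\<Sum>i\<in>I. c i * ip (f i) h)"
    if "finite I" "\<And>i. i \<in> I \<Longrightarrow> f i \<in> V" "h \<in> V" for I :: "'k set" and c f h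
    using that(1,2)
  proof (induction I rule: finite_induct)
    case empty
    show ?case using scale[OF V_zero V_zero that(3), of 0] by simp
  next
    case (insert j I)
    have "ip (\<lambda>x. c j * f j x + (\<Sum>i\<in>I. c i * f i x)) h =
        ip (\<lambda>x. c j * f j x) h + ip (\<lambda>x. \<Sum>i\<in>I. c i * f i x) h"
      by (rule add) (use insert.prems that(3) in \<open>auto intro: V_scale V_sum\<close>)
    then show ?case using insert that(3) by (simp add: scale)
  qed
  note finN = maximal_isotropicD(3)[OF N]
  have NK: "k \<in> carrier K" if "k \<in> N" for k
    using maximal_isotropicD(2)[OF N] that by blast
  fix S assume S: "S \<in> commutant N"
  obtain c where c: "\<And>f. f \<in> V \<Longrightarrow> S f = (\<lambda>x. \<Sum>k\<in>N. c k * \<rho> (lift_of k) f x)"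
    using commutant_expansion[OF N S] by blast
  define R where "R = (\<lambda>f\<in>V. \<lambda>x. \<Sum>k\<in>N. cnj (c k) * \<rho> (inv\<^bsub>G\<^esub> (lift_of k)) f x)"
  have "\<rho> (inv\<^bsub>G\<^esub> (lift_of k)) \<in> commutant N" if "k \<in> N" for k
  proof (rule rho_in_commutant[OF N])
    show "inv\<^bsub>G\<^esub> (lift_of k) \<in> ext_preimage G \<pi> N"
      using that NK subgroup.m_inv_closed[OF maximal_isotropicD(1)[OF N]]
      by (auto simp: ext_preimage_def)
  qed
  then have "R \<in> commutant N"
    unfolding R_def by (rule subalgebra_sum[OF commutant_subalgebra finN])
  moreover have "ip (S f) h = ip f (R h)" if f: "f \<in> V" and h: "h \<in> V" for f h
  proof -
    have Rh: "R h \<in> V" using \<open>R \<in> commutant N\<close> h by (simp add: commutantD(1) endomorphism_closed)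
    have adj: "ip (\<rho> (lift_of k) f) h = ip f (\<rho> (inv\<^bsub>G\<^esub> (lift_of k)) h)" if "k \<in> N" for k
      using inv[of "lift_of k" f "\<rho> (inv\<^bsub>G\<^esub> (lift_of k)) h"] f h NK[OF that]
      by (simp add: rho_closed rho_inverse)
    have "R h = (\<lambda>x. \<Sum>k\<in>N. cnj (c k) * \<rho> (inv\<^bsub>G\<^esub> (lift_of k)) h x)"
      using h by (simp add: R_def)
    then have sum: "ip (R h) f = (\<Sum>k\<in>N. cnj (c k) * ip (\<rho> (inv\<^bsub>G\<^esub> (lift_of k)) h) f)"
      using f h NK by (simp only:) (rule ip_sum[OF finN], auto simp: rho_closed)
    have "ip f (R h) = cnj (ip (R h) f)" using herm f Rh by blast
    also have "\<dots> = (\<Sum>k\<in>N. c k * ip f (\<rho> (inv\<^bsub>G\<^esub> (lift_of k)) h))"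
      unfolding sum using herm[OF rho_closed[OF h] f f] NK by simp
    also have "\<dots> = (\<Sum>k\<in>N. c k * ip (\<rho> (lift_of k) f) h)"
      by (simp add: adj)
    also have "\<dots> = ip (S f) h"
      unfolding c[OF f] using f h NK by (intro ip_sum[OF finN, symmetric]) (auto simp: rho_closed)
    finally show ?thesis ..
  qed
  ultimately show "\<exists>R\<in>commutant N. \<forall>f\<in>V. \<forall>h\<in>V. ip (S f) h = ip f (R h)" by blast
qed

section \<open>Central characters from joint eigenvectors\<close>

text \<open>If \<open>T\<close> is \<open>\<rho> a\<close> and \<open>T\<^sup>n w = c w\<close>, then \<open>(X\<^sup>n - c) / (X - \<mu>)\<close>, evaluated at \<open>T\<close> and applied to \<open>w\<close>,
  is an eigenvector for any root \<open>\<mu>\<close> of \<open>X\<^sup>n - c\<close>, provided it does not vanish.  At a point where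
  \<open>w\<close> does not vanish, its value is a nonzero polynomial in \<open>\<mu>\<close> of degree below \<open>n\<close>, which cannot
  have all \<open>n\<close> roots of \<open>X\<^sup>n - c\<close> as zeros.\<close>

lemma eigenvector_step:
  assumes w: "w \<in> V" "w \<noteq> (\<lambda>x. 0)" and a: "a \<in> carrier G" and c: "c \<noteq> 0"
    and pow: "\<rho> (a [^]\<^bsub>G\<^esub> Suc m) w = (\<lambda>x. c * w x)"
  obtains \<mu> b v where "v = (\<lambda>x. \<Sum>j\<le>m. b j * \<rho> (a [^]\<^bsub>G\<^esub> (m - j)) w x)"
    "v \<noteq> (\<lambda>x. 0)" "\<rho> a v = (\<lambda>x. \<mu> * v x)"
proof -
  obtain y where y: "w y \<noteq> 0" using w(2) by auto
  define v where "v \<mu> = (\<lambda>x. \<Sum>j\<le>m. \<mu> ^ j * \<rho> (a [^]\<^bsub>G\<^esub> (m - j)) w x)" for \<mu>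
  have "\<exists>\<mu>. \<mu> ^ Suc m = c \<and> v \<mu> y \<noteq> 0"
  proof (rule ccontr)
    assume "\<not> ?thesis"
    then have sub: "{\<mu>. \<mu> ^ Suc m = c} \<subseteq> {\<mu>. (\<Sum>j\<le>m. \<rho> (a [^]\<^bsub>G\<^esub> (m - j)) w y * \<mu> ^ j) = 0}"
      by (auto simp: v_def mult.commute)
    have "\<rho> (a [^]\<^bsub>G\<^esub> (m - m)) w y \<noteq> 0" using y w by (simp add: rho_one)
    then have "\<exists>k\<le>m. \<rho> (a [^]\<^bsub>G\<^esub> (m - k)) w y \<noteq> 0" by blast
    from polyfun_rootbound[OF this]
    have "card {\<mu>. \<mu> ^ Suc m = c} \<le> m"
      using card_mono[OF _ sub] by linarith
    moreover have "card {\<mu>. \<mu> ^ Suc m = c} = Suc m"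
      by (rule card_nth_roots[OF c]) simp
    ultimately show False by simp
  qed
  then obtain \<mu> where \<mu>: "\<mu> ^ Suc m = c" "v \<mu> y \<noteq> 0" by blast
  have "\<rho> a (v \<mu>) = (\<lambda>x. \<mu> * v \<mu> x)"
  proof
    fix x
    define g where "g j = \<mu> ^ j * \<rho> (a [^]\<^bsub>G\<^esub> (Suc m - j)) w x" for j
    have "\<rho> a (v \<mu>) = (\<lambda>x. \<Sum>j\<le>m. \<mu> ^ j * \<rho> a (\<rho> (a [^]\<^bsub>G\<^esub> (m - j)) w) x)"
      unfolding v_def using w a by (intro operator_sum[OF linear_rho]) (auto simp: rho_closed)
    moreover have "\<rho> a (\<rho> (a [^]\<^bsub>G\<^esub> (m - j)) w) = \<rho> (a [^]\<^bsub>G\<^esub> (Suc m - j)) w" if "j \<le> m" for j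
      using w a that by (simp add: rho_mult Suc_diff_le G.nat_pow_comm flip: G.nat_pow_Suc2)
    ultimately have 1: "\<rho> a (v \<mu>) x = (\<Sum>j\<le>m. g j)"
      by (simp add: g_def)
    have 2: "\<mu> * v \<mu> x = (\<Sum>j\<le>m. g (Suc j))"
      by (simp add: v_def g_def sum_distrib_left mult.assoc)
    have "(\<Sum>j\<le>m. g j) - (\<Sum>j\<le>m. g (Suc j)) = g 0 - g (Suc m)"
      unfolding sum_subtractf[symmetric] by (rule sum_telescope)
    also have "\<dots> = 0"
      using \<mu>(1) w fun_cong[OF pow, of x] by (simp add: g_def rho_one del: power_Suc G.nat_pow_Suc)
    finally show "\<rho> a (v \<mu>) x = \<mu> * v \<mu> x" using 1 2 by simp
  qed
  moreover have "v \<mu> \<noteq> (\<lambda>x. 0)" using \<mu>(2) by auto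
  ultimately show thesis using that[OF v_def] by blast
qed

text \<open>Powers to the order of \<open>K\<close> are central, which supplies the hypothesis of \<open>eigenvector_step\<close>
  and makes eigenvalues unimodular.\<close>

lemma central_power:
  assumes a: "a \<in> carrier G"
  obtains z where "cmod z = 1" "a [^]\<^bsub>G\<^esub> card (carrier K) = \<iota> z"
proof -
  have "\<pi> (a [^]\<^bsub>G\<^esub> card (carrier K)) = \<pi> \<one>\<^bsub>G\<^esub>"
    using a K.pow_order_eq_1[of "\<pi> a"] by (simp add: P.hom_nat_pow Coset.order_def)
  with a show thesis
    by (elim same_fibre[rotated 2]) (auto intro: that)
qed

text \<open>The eigenvectors are refined one element of \<open>N\<close> at a time: an eigenvector for a further
  element is found in the span of the translates of \<open>w\<close> by its powers, where the earlier elements,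
  which commute with it, still act by their eigenvalues.\<close>

lemma joint_eigenvector:
  assumes N: "maximal_isotropic G K \<iota> \<pi> N"
  obtains w where "w \<in> V" "w \<noteq> (\<lambda>x. 0)"
    "\<forall>h\<in>ext_preimage G \<pi> N. \<exists>c. \<rho> h w = (\<lambda>x. c * w x)"
proof -
  have NK: "k \<in> carrier K" if "k \<in> N" for k
    using maximal_isotropicD(2)[OF N] that by blast
  have "\<exists>w\<in>V. w \<noteq> (\<lambda>x. 0) \<and> (\<forall>k\<in>F. \<exists>c. \<rho> (lift_of k) w = (\<lambda>x. c * w x))"
    if "finite F" "F \<subseteq> N" for F
    using that
  proof (induction F rule: finite_induct)
    case empty
    have "\<delta> \<noteq> (\<lambda>x. 0)" using delta_one by auto
    then show ?case using delta_closed by blast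
  next
    case (insert k F)
    then obtain w where w: "w \<in> V" "w \<noteq> (\<lambda>x. 0)"
      and eig: "\<forall>k\<in>F. \<exists>c. \<rho> (lift_of k) w = (\<lambda>x. c * w x)" by auto
    let ?a = "lift_of k"
    have k: "k \<in> N" "k \<in> carrier K" using insert.prems NK by auto
    then have a: "?a \<in> carrier G" by simp
    obtain m where m: "card (carrier K) = Suc m"
      using finite_K K.one_closed by (cases "card (carrier K)") auto
    obtain z where z: "cmod z = 1" "?a [^]\<^bsub>G\<^esub> Suc m = \<iota> z"
      using central_power[OF a] unfolding m by blast
    have pow: "\<rho> (?a [^]\<^bsub>G\<^esub> Suc m) w = (\<lambda>x. z * w x)"
      unfolding z(2) by (rule rho_iota[OF w(1) z(1)])
    have z0: "z \<noteq> 0" using z(1) by auto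
    obtain \<mu> b v where v: "v = (\<lambda>x. \<Sum>j\<le>m. b j * \<rho> (?a [^]\<^bsub>G\<^esub> (m - j)) w x)"
      "v \<noteq> (\<lambda>x. 0)" "\<rho> ?a v = (\<lambda>x. \<mu> * v x)"
      by (rule eigenvector_step[OF w a z0 pow])
    have vV: "v \<in> V" unfolding v(1) using w a by (intro V_sum) (simp add: rho_closed)
    have "\<exists>c. \<rho> (lift_of l) v = (\<lambda>x. c * v x)" if l: "l \<in> F" for l
    proof -
      obtain c where c: "\<rho> (lift_of l) w = (\<lambda>x. c * w x)" using eig l by blast
      have lN: "l \<in> N" "l \<in> carrier K" using insert.prems l NK by auto
      have powN: "k [^]\<^bsub>K\<^esub> i \<in> N" for i :: nat
        using k subgroup.one_closed[OF maximal_isotropicD(1)[OF N]]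
          subgroup.m_closed[OF maximal_isotropicD(1)[OF N]] by (induction i) auto
      have "\<rho> (lift_of l) (\<rho> (?a [^]\<^bsub>G\<^esub> i) w) = (\<lambda>x. c * \<rho> (?a [^]\<^bsub>G\<^esub> i) w x)" for i :: nat
      proof -
        have "\<rho> (lift_of l) (\<rho> (?a [^]\<^bsub>G\<^esub> i) w) = \<rho> (?a [^]\<^bsub>G\<^esub> i) (\<rho> (lift_of l) w)"
          using rho_swap[of w "lift_of l" "?a [^]\<^bsub>G\<^esub> i"] w a k lN powN maximal_isotropicD(4)[OF N]
          by (simp add: P.hom_nat_pow)
        then show ?thesis unfolding c using w a by (simp add: operator_scale[OF linear_rho])
      qed
      then have "\<rho> (lift_of l) v = (\<lambda>x. \<Sum>j\<le>m. b j * (c * \<rho> (?a [^]\<^bsub>G\<^esub> (m - j)) w x))"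
        unfolding v(1) using w a lN
        by (subst operator_sum[OF linear_rho]) (auto simp: rho_closed)
      also have "\<dots> = (\<lambda>x. c * v x)"
        unfolding v(1) by (simp add: sum_distrib_left mult.left_commute)
      finally show ?thesis by blast
    qed
    then show ?case using v vV by blast
  qed
  from this[OF maximal_isotropicD(3)[OF N] subset_refl]
  obtain w where w: "w \<in> V" "w \<noteq> (\<lambda>x. 0)"
    and eig: "\<forall>k\<in>N. \<exists>c. \<rho> (lift_of k) w = (\<lambda>x. c * w x)" by blast
  have "\<exists>c. \<rho> h w = (\<lambda>x. c * w x)" if h: "h \<in> ext_preimage G \<pi> N" for h
  proof -
    have hG: "h \<in> carrier G" "\<pi> h \<in> N" using h by (auto simp: ext_preimage_def)
    then obtain c where c: "\<rho> (lift_of (\<pi> h)) w = (\<lambda>x. c * w x)" using eig by blast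
    obtain z where z: "cmod z = 1" "h = \<iota> z \<otimes>\<^bsub>G\<^esub> lift_of (\<pi> h)"
      using same_fibre[of h "lift_of (\<pi> h)"] hG by (metis P.hom_closed lift_of_closed pi_lift_of)
    have "\<rho> h w = \<rho> (\<iota> z) (\<rho> (lift_of (\<pi> h)) w)"
      using z hG w by (metis P.hom_closed iota_closed lift_of_closed rho_mult)
    also have "\<dots> = (\<lambda>x. z * (c * w x))"
      unfolding c using w z by (simp add: rho_iota V_scale)
    finally show ?thesis by (metis (no_types, lifting) mult.assoc)
  qed
  then show thesis using that w by blast
qed

end

context circle_extension
begin

text \<open>The fibres of \<open>\<pi>\<close> are open, and a left translation carries each of them to the image of
  \<open>\<iota>\<close>, where the character is the inverse of \<open>\<iota>\<close>.\<close>

lemma central_character_continuous: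
  fixes \<psi> :: "'g \<Rightarrow> complex" and N :: "'k set"
  defines "L \<equiv> ext_preimage G \<pi> N"
  assumes N: "subgroup N K"
    and mult: "\<And>h h'. h \<in> L \<Longrightarrow> h' \<in> L \<Longrightarrow> \<psi> (h \<otimes>\<^bsub>G\<^esub> h') = \<psi> h * \<psi> h'"
    and norm: "\<And>h. h \<in> L \<Longrightarrow> cmod (\<psi> h) = 1"
    and central: "\<And>z. cmod z = 1 \<Longrightarrow> \<psi> (\<iota> z) = z"
  shows "continuous_map (subtopology X L) circle_topology \<psi>"
proof -
  let ?C = "\<iota> ` topspace circle_topology"
  obtain \<kappa> where \<kappa>: "continuous_map (subtopology X ?C) circle_topology \<kappa>"
    "\<And>z. cmod z = 1 \<Longrightarrow> \<kappa> (\<iota> z) = z"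
    using iota_embedding
    unfolding embedding_map_def homeomorphic_map_maps homeomorphic_maps_def
    by (auto simp: circle_topology_def)
  have L: "h \<in> carrier G" "\<pi> h \<in> N" "\<pi> h \<in> carrier K" if "h \<in> L" for h
    using that by (auto simp: L_def ext_preimage_def)
  have NK: "k \<in> carrier K" if "k \<in> N" for k using N that by (rule subgroup.mem_carrier)
  have top: "topspace (subtopology X L) = L" using L by (auto simp: topspace_X)
  define T where "T k = {h \<in> L. \<pi> h = k}" for k
  define f where "f k h = \<psi> (lift_of k) * \<kappa> (inv\<^bsub>G\<^esub> (lift_of k) \<otimes>\<^bsub>G\<^esub> h)" for k h
  have liftL: "lift_of k \<in> L" if "k \<in> N" for k
    using that NK by (simp add: L_def ext_preimage_def)
  have fibre: "\<exists>z. cmod z = 1 \<and> inv\<^bsub>G\<^esub> (lift_of k) \<otimes>\<^bsub>G\<^esub> h = \<iota> z \<and> h = lift_of k \<otimes>\<^bsub>G\<^esub> \<iota> z"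
    if k: "k \<in> N" and h: "h \<in> T k" for k h
  proof -
    have hG: "h \<in> carrier G" "\<pi> h = k" and l: "lift_of k \<in> carrier G"
      using h L NK[OF k] by (auto simp: T_def)
    obtain z where z: "cmod z = 1" "h = \<iota> z \<otimes>\<^bsub>G\<^esub> lift_of k"
      using same_fibre[of h "lift_of k"] hG l NK[OF k] by (metis pi_lift_of)
    then have "h = lift_of k \<otimes>\<^bsub>G\<^esub> \<iota> z" using l by (simp add: iota_central)
    moreover have "inv\<^bsub>G\<^esub> (lift_of k) \<otimes>\<^bsub>G\<^esub> (lift_of k \<otimes>\<^bsub>G\<^esub> \<iota> z) = \<iota> z"
      using l z(1) by (simp flip: G.m_assoc)
    ultimately show ?thesis using z(1) by metis
  qed
  show ?thesis
  proof (rule pasting_lemma[where I = N and T = T and f = f])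
    fix k assume k: "k \<in> N"
    have "openin X {h \<in> topspace X. \<pi> h \<in> {k}}"
      by (rule openin_continuous_map_preimage[OF pi_continuous]) (use NK[OF k] in simp)
    moreover have "T k = L \<inter> {h \<in> topspace X. \<pi> h \<in> {k}}"
      using L by (auto simp: T_def topspace_X)
    ultimately show "openin (subtopology X L) (T k)"
      by (simp add: openin_subtopology_Int2)
    have l: "lift_of k \<in> carrier G" using NK[OF k] by simp
    have "continuous_map X (prod_topology X X) (\<lambda>h. (inv\<^bsub>G\<^esub> (lift_of k), h))"
      using l by (intro continuous_map_pairedI) (auto simp: topspace_X)
    from continuous_map_compose[OF this mult_continuous]
    have "continuous_map X X (\<lambda>h. inv\<^bsub>G\<^esub> (lift_of k) \<otimes>\<^bsub>G\<^esub> h)"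
      by (simp add: o_def)
    then have "continuous_map (subtopology (subtopology X L) (T k)) X (\<lambda>h. inv\<^bsub>G\<^esub> (lift_of k) \<otimes>\<^bsub>G\<^esub> h)"
      by (intro continuous_map_from_subtopology)
    moreover have "(\<lambda>h. inv\<^bsub>G\<^esub> (lift_of k) \<otimes>\<^bsub>G\<^esub> h) \<in>
        topspace (subtopology (subtopology X L) (T k)) \<rightarrow> ?C"
      using fibre[OF k] by (fastforce simp: circle_topology_def)
    ultimately have "continuous_map (subtopology (subtopology X L) (T k)) (subtopology X ?C)
        (\<lambda>h. inv\<^bsub>G\<^esub> (lift_of k) \<otimes>\<^bsub>G\<^esub> h)"
      by (rule continuous_map_into_subtopology)
    from continuous_map_compose[OF this \<kappa>(1)]
    have *: "continuous_map (subtopology (subtopology X L) (T k)) circle_topology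
        (\<lambda>h. \<kappa> (inv\<^bsub>G\<^esub> (lift_of k) \<otimes>\<^bsub>G\<^esub> h))"
      by (simp add: o_def)
    have "continuous_map circle_topology circle_topology (\<lambda>z. \<psi> (lift_of k) * z)"
      using norm[OF liftL[OF k]]
      by (auto simp: circle_topology_def norm_mult intro!: continuous_intros)
    from continuous_map_compose[OF * this]
    show "continuous_map (subtopology (subtopology X L) (T k)) circle_topology (f k)"
      by (simp add: o_def f_def[abs_def])
  next
    fix h assume "h \<in> topspace (subtopology X L)"
    then have h: "h \<in> L" by (simp add: top)
    let ?k = "\<pi> h"
    have k: "?k \<in> N" "h \<in> T ?k" using h L by (auto simp: T_def)
    obtain z where z: "cmod z = 1" "inv\<^bsub>G\<^esub> (lift_of ?k) \<otimes>\<^bsub>G\<^esub> h = \<iota> z" "h = lift_of ?k \<otimes>\<^bsub>G\<^esub> \<iota> z"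
      using fibre[OF k] by blast
    have "\<iota> z \<in> L"
      using z(1) subgroup.one_closed[OF N] by (simp add: L_def ext_preimage_def)
    then have "\<psi> (lift_of ?k \<otimes>\<^bsub>G\<^esub> \<iota> z) = \<psi> (lift_of ?k) * z"
      using mult[OF liftL[OF k(1)]] central[OF z(1)] by simp
    then have "\<psi> h = f ?k h"
      using z \<kappa>(2)[OF z(1)] by (simp add: f_def flip: z(3))
    then show "\<exists>j. j \<in> N \<and> h \<in> T j \<and> \<psi> h = f j h" using k by blast
  qed (auto simp: T_def)
qed

end

context induced_model
begin

text \<open>The eigenvalues are multiplicative in \<open>h\<close>, and their powers to the order of \<open>K\<close> are eigenvalues of
  central elements, hence unimodular.  Continuity then comes from \<open>central_character_continuous\<close>.\<close>

lemma eigencharacter: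
  assumes N: "maximal_isotropic G K \<iota> \<pi> N" and w: "w \<in> V" "w \<noteq> (\<lambda>x. 0)"
    and eig: "\<forall>h\<in>ext_preimage G \<pi> N. \<exists>c. \<rho> h w = (\<lambda>x. c * w x)"
  obtains \<psi> where "\<psi> \<in> central_characters G X \<iota> \<pi> N"
    "\<forall>h\<in>ext_preimage G \<pi> N. \<rho> h w = (\<lambda>x. \<psi> h * w x)"
proof -
  let ?L = "ext_preimage G \<pi> N"
  note subN = maximal_isotropicD(1)[OF N]
  obtain y where y: "w y \<noteq> 0" using w(2) by auto
  define \<psi> where "\<psi> = (\<lambda>h\<in>?L. \<rho> h w y / w y)"
  have chi: "\<rho> h w = (\<lambda>x. \<psi> h * w x)" if h: "h \<in> ?L" for h
    using bspec[OF eig h] h y by (auto simp: \<psi>_def)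
  have uniq: "\<psi> h = c" if "h \<in> ?L" "\<rho> h w = (\<lambda>x. c * w x)" for h c
    using that y by (simp add: \<psi>_def)
  have LG: "h \<in> carrier G" if "h \<in> ?L" for h using that by (simp add: ext_preimage_def)
  have Lm: "h \<otimes>\<^bsub>G\<^esub> h' \<in> ?L" if "h \<in> ?L" "h' \<in> ?L" for h h'
    using that subgroup.m_closed[OF subN] by (simp add: ext_preimage_def)
  have Li: "\<iota> z \<in> ?L" if "cmod z = 1" for z
    using that subgroup.one_closed[OF subN] by (simp add: ext_preimage_def)
  have mult: "\<psi> (h \<otimes>\<^bsub>G\<^esub> h') = \<psi> h * \<psi> h'" if h: "h \<in> ?L" "h' \<in> ?L" for h h'
  proof (rule uniq[OF Lm[OF h]])
    have "\<rho> (h \<otimes>\<^bsub>G\<^esub> h') w = \<rho> h (\<rho> h' w)" using h w LG by (simp add: rho_mult)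
    also have "\<dots> = (\<lambda>x. \<psi> h' * (\<psi> h * w x))"
      unfolding chi[OF h(2)] operator_scale[OF linear_rho[OF LG[OF h(1)]] w(1)] chi[OF h(1)] ..
    finally show "\<rho> (h \<otimes>\<^bsub>G\<^esub> h') w = (\<lambda>x. \<psi> h * \<psi> h' * w x)"
      by (simp add: mult.assoc mult.left_commute)
  qed
  have iota: "\<psi> (\<iota> z) = z" if "cmod z = 1" for z
    by (rule uniq[OF Li[OF that] rho_iota[OF w(1) that]])
  have pow: "h [^]\<^bsub>G\<^esub> i \<in> ?L \<and> \<psi> (h [^]\<^bsub>G\<^esub> i) = \<psi> h ^ i" if h: "h \<in> ?L" for h and i :: nat
    using h iota[of 1] Li[of 1] Lm mult by (induction i) (auto simp: mult.commute)
  have norm: "cmod (\<psi> h) = 1" if h: "h \<in> ?L" for h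
  proof -
    obtain z where z: "cmod z = 1" "h [^]\<^bsub>G\<^esub> card (carrier K) = \<iota> z"
      by (rule central_power[OF LG[OF h]])
    then have "\<psi> h ^ card (carrier K) = z" using pow[OF h, of "card (carrier K)"] iota by simp
    then have "cmod (\<psi> h) ^ card (carrier K) = 1" using z(1) by (simp flip: norm_power)
    moreover have "card (carrier K) > 0" using finite_K K.one_closed card_gt_0_iff by blast
    ultimately show ?thesis using power_eq_1_iff[of "cmod (\<psi> h)"] by force
  qed
  have "\<psi> \<in> extensional ?L" by (simp add: \<psi>_def)
  then have "\<psi> \<in> central_characters G X \<iota> \<pi> N"
    unfolding central_characters_def unitary_characters_def
    using central_character_continuous[OF subN mult norm iota] mult norm iota
    by (auto simp: hom_def mult_circle_group carrier_circle_group)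
  then show thesis using chi that by blast
qed

section \<open>Intertwining operators\<close>

text \<open>The transform \<open>f \<mapsto> (g \<mapsto> \<langle>\<rho> g f, w\<rangle>)\<close> attached to an eigenvector \<open>w\<close> of the preimage of \<open>N\<close>
  maps into the model of \<open>N\<close>, and \<open>F \<mapsto> \<Sum> F(g) \<rho>(g)\<^sup>-\<^sup>1 w\<close>, summed modulo the centre, maps back.  Both
  composites are scalar by Schur's lemma applied to the two models.  The function \<open>\<delta>\<close> of the model
  of \<open>N\<close> is sent to a positive multiple of \<open>w\<close>, and the transform of \<open>w\<close> takes the value
  \<open>\<langle>w, w\<rangle>\<close> at the identity, so the scalars are not zero.\<close>

lemma model_isomorphism:
  assumes L: "induced_model G X K \<iota> \<pi> N \<psi>"
    and w: "w \<in> V" "w \<noteq> (\<lambda>x. 0)"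
    and eig: "\<forall>h\<in>ext_preimage G \<pi> N. \<rho> h w = (\<lambda>x. \<psi> h * w x)"
  obtains \<Phi> where
    "rep_isomorphism G V \<rho> (induced_space G \<pi> N \<psi>) (induced_rep G \<pi> N \<psi>) \<Phi>"
proof -
  interpret L: induced_model G X K \<iota> \<pi> N \<psi> by (rule L)
  have w_right: "w (x \<otimes>\<^bsub>G\<^esub> h) = \<psi> h * w x" if "h \<in> L.H" "x \<in> carrier G" for h x
    using fun_cong[OF bspec[OF eig that(1)], of x] that w by (simp add: rho_apply)
  define \<Phi> :: "'g operator"
    where "\<Phi> f = (\<lambda>g. if g \<in> carrier G
      then \<Sum>k\<in>carrier K. cnj (w (lift_of k)) * f (lift_of k \<otimes>\<^bsub>G\<^esub> g) else 0)" for f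
  define \<Psi> :: "'g operator"
    where "\<Psi> F = (\<lambda>x. if x \<in> carrier G
      then \<Sum>k\<in>carrier K. F (lift_of k) * w (x \<otimes>\<^bsub>G\<^esub> inv\<^bsub>G\<^esub> (lift_of k)) else 0)" for F
  have cnj_mult: "cnj z * z = 1" if "cmod z = 1" for z
    using complex_norm_square[of z] that by (simp add: mult.commute)
  have \<Phi>_closed: "\<Phi> f \<in> L.V" if f: "f \<in> V" for f
  proof (rule L.VI)
    fix h g assume h: "h \<in> L.H" and g: "g \<in> carrier G"
    have hG: "h \<in> carrier G" using h by (rule L.H_closed)
    define \<phi> where "\<phi> y = cnj (w y) * f (y \<otimes>\<^bsub>G\<^esub> (h \<otimes>\<^bsub>G\<^esub> g))" for y
    define \<phi>' where "\<phi>' y = cnj (w y) * f (y \<otimes>\<^bsub>G\<^esub> g)" for y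
    have inv: "\<phi>' (\<iota> z \<otimes>\<^bsub>G\<^esub> x) = \<phi>' x" if "cmod z = 1" "x \<in> carrier G" for z x
      using that cnj_mult[of z] f w g by (simp add: \<phi>'_def V_iota G.m_assoc)
    have "\<phi> y = \<psi> h * \<phi>' (y \<otimes>\<^bsub>G\<^esub> h)" if "y \<in> carrier G" for y
      using that h hG g w_right[OF h that] L.xi_cnj[OF h]
      by (simp add: \<phi>_def \<phi>'_def G.m_assoc mult.commute)
    then have "(\<Sum>k\<in>carrier K. \<phi> (lift_of k)) = \<psi> h * (\<Sum>k\<in>carrier K. \<phi>' (lift_of k \<otimes>\<^bsub>G\<^esub> h))"
      by (simp add: sum_distrib_left)
    also have "\<dots> = \<psi> h * (\<Sum>k\<in>carrier K. \<phi>' (lift_of k))"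
      by (simp only: sum_lift_shift_right[of \<phi>', OF inv hG])
    finally show "\<Phi> f (h \<otimes>\<^bsub>G\<^esub> g) = \<psi> h * \<Phi> f g"
      using hG g by (simp add: \<Phi>_def \<phi>_def \<phi>'_def)
  qed (simp add: \<Phi>_def)
  have \<Phi>_linear: "linear_between V L.V \<Phi>"
    using \<Phi>_closed unfolding linear_between_def
    by (auto simp: \<Phi>_def fun_eq_iff algebra_simps sum.distrib sum_distrib_left)
  have \<Phi>_comm: "\<Phi> (\<rho> a f) = L.\<rho> a (\<Phi> f)" if "a \<in> carrier G" "f \<in> V" for a f
    unfolding fun_eq_iff L.rho_apply[OF \<Phi>_closed[OF that(2)]]
    using that by (auto simp: \<Phi>_def rho_apply G.m_assoc)
  have \<Psi>_closed: "\<Psi> F \<in> V" if "F \<in> L.V" for F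
    by (rule VI) (auto simp: \<Psi>_def H_closed G.m_assoc V_left[OF w(1)] sum_distrib_left
        mult.left_commute intro!: sum.cong)
  have \<Psi>_linear: "linear_between L.V V \<Psi>"
    using \<Psi>_closed unfolding linear_between_def
    by (auto simp: \<Psi>_def fun_eq_iff algebra_simps sum.distrib sum_distrib_left)
  have \<Psi>_comm: "\<Psi> (L.\<rho> a F) = \<rho> a (\<Psi> F)" if a: "a \<in> carrier G" and F: "F \<in> L.V" for a F
  proof
    fix x
    show "\<Psi> (L.\<rho> a F) x = \<rho> a (\<Psi> F) x"
    proof (cases "x \<in> carrier G")
      case True
      define \<phi> where "\<phi> y = F y * w (x \<otimes>\<^bsub>G\<^esub> a \<otimes>\<^bsub>G\<^esub> inv\<^bsub>G\<^esub> y)" for y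
      have inv: "\<phi> (\<iota> z \<otimes>\<^bsub>G\<^esub> y) = \<phi> y" if z: "cmod z = 1" and y: "y \<in> carrier G" for z y
      proof -
        have z0: "z \<noteq> 0" "cmod (inverse z) = 1" using z by (auto simp: norm_inverse)
        have "x \<otimes>\<^bsub>G\<^esub> a \<otimes>\<^bsub>G\<^esub> inv\<^bsub>G\<^esub> (\<iota> z \<otimes>\<^bsub>G\<^esub> y) = x \<otimes>\<^bsub>G\<^esub> a \<otimes>\<^bsub>G\<^esub> inv\<^bsub>G\<^esub> y \<otimes>\<^bsub>G\<^esub> \<iota> (inverse z)"
          using z y a True iota_closed[OF z0(2)]
          by (simp add: G.inv_mult_group iota_inverse G.m_assoc)
        also have "\<dots> = \<iota> (inverse z) \<otimes>\<^bsub>G\<^esub> (x \<otimes>\<^bsub>G\<^esub> a \<otimes>\<^bsub>G\<^esub> inv\<^bsub>G\<^esub> y)"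
          using z0 y a True by (intro iota_central) auto
        finally have "w (x \<otimes>\<^bsub>G\<^esub> a \<otimes>\<^bsub>G\<^esub> inv\<^bsub>G\<^esub> (\<iota> z \<otimes>\<^bsub>G\<^esub> y)) = inverse z * w (x \<otimes>\<^bsub>G\<^esub> a \<otimes>\<^bsub>G\<^esub> inv\<^bsub>G\<^esub> y)"
          using V_iota[OF w(1) z0(2)] y a True by simp
        then show ?thesis using L.V_iota[OF F z y] z0 by (simp add: \<phi>_def)
      qed
      have "x \<otimes>\<^bsub>G\<^esub> a \<otimes>\<^bsub>G\<^esub> inv\<^bsub>G\<^esub> (y \<otimes>\<^bsub>G\<^esub> a) = x \<otimes>\<^bsub>G\<^esub> inv\<^bsub>G\<^esub> y" if "y \<in> carrier G" for y
      proof -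
        have "a \<otimes>\<^bsub>G\<^esub> (inv\<^bsub>G\<^esub> a \<otimes>\<^bsub>G\<^esub> inv\<^bsub>G\<^esub> y) = inv\<^bsub>G\<^esub> y"
          using that a by (simp flip: G.m_assoc)
        then show ?thesis using that a True by (simp add: G.inv_mult_group G.m_assoc)
      qed
      then have "\<Psi> (L.\<rho> a F) x = (\<Sum>k\<in>carrier K. \<phi> (lift_of k \<otimes>\<^bsub>G\<^esub> a))"
        using True F a by (simp add: \<Psi>_def \<phi>_def L.rho_apply)
      also have "\<dots> = (\<Sum>k\<in>carrier K. \<phi> (lift_of k))"
        by (rule sum_lift_shift_right[OF inv a])
      finally show ?thesis
        unfolding rho_apply[OF \<Psi>_closed[OF F]] using True a by (simp add: \<Psi>_def \<phi>_def)
    qed (simp add: \<Psi>_def[of "L.\<rho> a F"] rho_apply[OF \<Psi>_closed[OF F]])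
  qed
  \<comment> \<open>The scalars \<open>c\<close> and \<open>d\<close> of the two composites will agree because \<open>c * \<Phi> w\<close> and \<open>d * \<Phi> w\<close>
    both equal \<open>\<Phi> (\<Psi> (\<Phi> w))\<close>.\<close>
  have "linear_between V V (\<lambda>f. \<Psi> (\<Phi> f))"
    using \<Phi>_linear \<Psi>_linear by (auto simp: linear_between_def Pi_iff)
  then obtain c where c: "\<And>f. f \<in> V \<Longrightarrow> \<Psi> (\<Phi> f) = (\<lambda>x. c * f x)"
    by (rule schur) (auto simp: \<Phi>_comm \<Psi>_comm \<Phi>_closed)
  have "linear_between L.V L.V (\<lambda>F. \<Phi> (\<Psi> F))"
    using \<Phi>_linear \<Psi>_linear by (auto simp: linear_between_def Pi_iff)
  then obtain d where d: "\<And>F. F \<in> L.V \<Longrightarrow> \<Phi> (\<Psi> F) = (\<lambda>x. d * F x)"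
    by (rule L.schur) (auto simp: \<Phi>_comm \<Psi>_comm \<Psi>_closed)
  have "\<Psi> L.\<delta> = (\<lambda>x. of_nat (card N) * w x)"
  proof
    fix x
    show "\<Psi> L.\<delta> x = of_nat (card N) * w x"
    proof (cases "x \<in> carrier G")
      case True
      have "L.\<delta> (lift_of k) * w (x \<otimes>\<^bsub>G\<^esub> inv\<^bsub>G\<^esub> (lift_of k)) = (if k \<in> N then w x else 0)"
        if k: "k \<in> carrier K" for k
      proof (cases "k \<in> N")
        case True
        have l: "lift_of k \<in> L.H" "inv\<^bsub>G\<^esub> (lift_of k) \<in> L.H"
          using True k subgroup.m_inv_closed[OF L.subgroup_M] by (auto simp: L.H_iff)
        have "\<psi> (lift_of k) * \<psi> (inv\<^bsub>G\<^esub> (lift_of k)) = 1"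
          using L.xi_mult[OF l] L.xi_one k by simp
        then show ?thesis
          using l w_right[OF l(2) \<open>x \<in> carrier G\<close>] True by (simp add: L.\<delta>_def flip: mult.assoc)
      qed (use k in \<open>simp add: L.\<delta>_def L.H_iff\<close>)
      then have "\<Psi> L.\<delta> x = (\<Sum>k\<in>carrier K. if k \<in> N then w x else 0)"
        using True by (simp add: \<Psi>_def)
      also have "\<dots> = (\<Sum>k\<in>carrier K \<inter> N. w x)"
        using finite_K by (rule sum.inter_restrict[symmetric])
      also have "carrier K \<inter> N = N" using L.M_closed by auto
      finally show ?thesis by simp
    qed (simp add: \<Psi>_def V_outside[OF w(1)])
  qed
  then have "\<Phi> (\<Psi> L.\<delta>) = (\<lambda>x. of_nat (card N) * \<Phi> w x)"
    using \<Phi>_linear w(1) by (simp add: linear_between_def)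
  then have "d = of_nat (card N) * \<Phi> w \<one>\<^bsub>G\<^esub>"
    using fun_cong[OF d[OF L.delta_closed], of "\<one>\<^bsub>G\<^esub>"] by (simp add: L.delta_one)
  moreover have w1: "\<Phi> w \<one>\<^bsub>G\<^esub> \<noteq> 0"
  proof -
    have sq: "cnj (w y) * w y = of_real ((cmod (w y))\<^sup>2)" for y
      using complex_norm_square[of "w y"] by (simp add: mult.commute)
    then have "\<Phi> w \<one>\<^bsub>G\<^esub> = of_real (\<Sum>k\<in>carrier K. (cmod (w (lift_of k)))\<^sup>2)"
      by (simp add: \<Phi>_def)
    moreover have "\<exists>k\<in>carrier K. w (lift_of k) \<noteq> 0"
    proof -
      obtain y where y: "w y \<noteq> 0" using w(2) by auto
      then have yG: "y \<in> carrier G" using V_outside[OF w(1)] by blast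
      obtain z where z: "cmod z = 1" "y = \<iota> z \<otimes>\<^bsub>G\<^esub> lift_of (\<pi> y)"
        using same_fibre[of y "lift_of (\<pi> y)"] yG by (metis P.hom_closed lift_of_closed pi_lift_of)
      have "w y = z * w (lift_of (\<pi> y))"
        using V_iota[OF w(1) z(1), of "lift_of (\<pi> y)"] yG by (simp flip: z(2))
      then show ?thesis using y yG by (intro bexI[of _ "\<pi> y"]) auto
    qed
    then have "(\<Sum>k\<in>carrier K. (cmod (w (lift_of k)))\<^sup>2) \<noteq> 0"
      using finite_K by (simp add: sum_nonneg_eq_0_iff)
    ultimately show ?thesis by (simp only: of_real_eq_0_iff not_False_eq_True)
  qed
  ultimately have d0: "d \<noteq> 0" using L.card_M by simp
  have "\<Phi> (\<Psi> (\<Phi> w)) = (\<lambda>x. c * \<Phi> w x)"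
    unfolding c[OF w(1)] using \<Phi>_linear w(1) by (simp add: linear_between_def)
  then have "c * \<Phi> w \<one>\<^bsub>G\<^esub> = d * \<Phi> w \<one>\<^bsub>G\<^esub>"
    using d[OF \<Phi>_closed[OF w(1)]] by (metis (no_types))
  then have cd: "c = d" using w1 by simp
  have "bij_betw \<Phi> V L.V"
  proof (rule bij_betw_byWitness[where f' = "\<lambda>F x. inverse d * \<Psi> F x"])
    show "\<forall>f\<in>V. (\<lambda>x. inverse d * \<Psi> (\<Phi> f) x) = f"
      using c d0 by (simp add: cd flip: mult.assoc)
    have "\<Phi> (\<lambda>x. inverse d * \<Psi> F x) = (\<lambda>x. inverse d * \<Phi> (\<Psi> F) x)" if "F \<in> L.V" for F
      using \<Phi>_linear \<Psi>_closed[OF that] by (simp add: linear_between_def)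
    then show "\<forall>F\<in>L.V. \<Phi> (\<lambda>x. inverse d * \<Psi> F x) = F"
      using d d0 by (simp flip: mult.assoc)
    show "\<Phi> ` V \<subseteq> L.V" using \<Phi>_closed by blast
    show "(\<lambda>F x. inverse d * \<Psi> F x) ` L.V \<subseteq> V" using \<Psi>_closed V_scale by blast
  qed
  then have "rep_isomorphism G V \<rho> L.V L.\<rho> \<Phi>"
    using \<Phi>_linear \<Phi>_comm by (simp add: rep_isomorphism_def)
  then show thesis by (rule that)
qed

lemma isomorphic_model_exists:
  assumes N: "maximal_isotropic G K \<iota> \<pi> N"
  obtains \<psi> \<Phi> where "\<psi> \<in> central_characters G X \<iota> \<pi> N"
    "rep_isomorphism G V \<rho> (induced_space G \<pi> N \<psi>) (induced_rep G \<pi> N \<psi>) \<Phi>"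
proof -
  obtain w where w: "w \<in> V" "w \<noteq> (\<lambda>x. 0)"
    and eig: "\<forall>h\<in>ext_preimage G \<pi> N. \<exists>c. \<rho> h w = (\<lambda>x. c * w x)"
    by (rule joint_eigenvector[OF N])
  obtain \<psi> where psi: "\<psi> \<in> central_characters G X \<iota> \<pi> N"
    "\<forall>h\<in>ext_preimage G \<pi> N. \<rho> h w = (\<lambda>x. \<psi> h * w x)"
    by (rule eigencharacter[OF N w eig])
  have "induced_model G X K \<iota> \<pi> N \<psi>"
    by (intro induced_model.intro induced_model_axioms.intro heisenberg_group_axioms N psi(1))
  from model_isomorphism[OF this w psi(2)] show thesis using that[OF psi(1)] by blast
qed

section \<open>Multiplication algebras as commutants\<close>

lemma transport_commutant:
  assumes L: "induced_model G X K \<iota> \<pi> N' \<psi>"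
    and \<Phi>: "linear_between V (induced_space G \<pi> N' \<psi>) \<Phi>"
    and \<Psi>: "linear_between (induced_space G \<pi> N' \<psi>) V \<Psi>"
    and \<Phi>_comm: "\<And>g f. g \<in> carrier G \<Longrightarrow> f \<in> V \<Longrightarrow> \<Phi> (\<rho> g f) = induced_rep G \<pi> N' \<psi> g (\<Phi> f)"
    and \<Psi>_comm: "\<And>g F. g \<in> carrier G \<Longrightarrow> F \<in> induced_space G \<pi> N' \<psi> \<Longrightarrow>
      \<Psi> (induced_rep G \<pi> N' \<psi> g F) = \<rho> g (\<Psi> F)"
    and S: "S \<in> induced_model.commutant G \<pi> N' \<psi> N"
  shows "(\<lambda>f\<in>V. \<Psi> (S (\<Phi> f))) \<in> commutant N"
proof -
  interpret L: induced_model G X K \<iota> \<pi> N' \<psi> by (rule L)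
  have \<Phi>_closed: "\<Phi> f \<in> L.V" if "f \<in> V" for f using \<Phi> that by (auto simp: linear_between_def)
  note SE = L.commutantD(1)[OF S]
  show ?thesis
  proof (rule commutant_restrictI)
    show "linear_between V V (\<lambda>f. \<Psi> (S (\<Phi> f)))"
      using \<Phi> \<Psi> L.endomorphism_linear[OF SE] by (auto simp: linear_between_def Pi_iff)
    fix h f assume h: "h \<in> ext_preimage G \<pi> N" and f: "f \<in> V"
    then have hG: "h \<in> carrier G" by (simp add: ext_preimage_def)
    show "\<Psi> (S (\<Phi> (\<rho> h f))) = \<rho> h (\<Psi> (S (\<Phi> f)))"
      using h hG f
      by (simp add: \<Phi>_comm \<Psi>_comm L.commutantD(2)[OF S] \<Phi>_closed L.endomorphism_closed[OF SE])
  qed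
qed

text \<open>An isomorphism of representations carries the commutant of the preimage of \<open>N\<close> in one model
  to that in the other, and in the model of \<open>N\<close> the commutant is the algebra of multiplications.
  This is also why the result does not depend on the character or on the isomorphism.\<close>

lemma transported_mult_algebra_eq_commutant:
  assumes L: "induced_model G X K \<iota> \<pi> N \<psi>"
    and \<Phi>: "rep_isomorphism G V \<rho> (induced_space G \<pi> N \<psi>) (induced_rep G \<pi> N \<psi>) \<Phi>"
  shows "transported_mult_algebra G \<pi> V N \<psi> \<Phi> = commutant N"
proof -
  interpret L: induced_model G X K \<iota> \<pi> N \<psi> by (rule L)
  let ?\<Psi> = "inv_into V \<Phi>"
  have lin: "linear_between V L.V \<Phi>" and bij: "bij_betw \<Phi> V L.V"
    and comm: "\<And>g f. g \<in> carrier G \<Longrightarrow> f \<in> V \<Longrightarrow> \<Phi> (\<rho> g f) = L.\<rho> g (\<Phi> f)"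
    using \<Phi> by (auto simp: rep_isomorphism_def)
  have \<Psi>\<Phi>: "?\<Psi> (\<Phi> f) = f" if "f \<in> V" for f
    using bij that by (simp add: bij_betw_inv_into_left)
  have \<Phi>\<Psi>: "\<Phi> (?\<Psi> F) = F" "?\<Psi> F \<in> V" if "F \<in> L.V" for F
    using bij that bij_betw_inv_into[OF bij]
    by (auto simp: bij_betw_inv_into_right dest: bij_betwE)
  have \<Phi>_closed: "\<Phi> f \<in> L.V" if "f \<in> V" for f using lin that by (auto simp: linear_between_def)
  have lin': "linear_between L.V V ?\<Psi>"
    unfolding linear_between_def
  proof (intro conjI ballI allI)
    fix F F' c assume F: "F \<in> L.V"
    show "?\<Psi> (\<lambda>x. c * F x) = (\<lambda>x. c * ?\<Psi> F x)"
      using \<Psi>\<Phi>[OF V_scale[OF \<Phi>\<Psi>(2)[OF F], of c]] operator_scale[OF lin \<Phi>\<Psi>(2)[OF F], of c] \<Phi>\<Psi>(1)[OF F]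
      by simp
    assume F': "F' \<in> L.V"
    show "?\<Psi> (\<lambda>x. F x + F' x) = (\<lambda>x. ?\<Psi> F x + ?\<Psi> F' x)"
      using \<Psi>\<Phi>[OF V_add[OF \<Phi>\<Psi>(2)[OF F] \<Phi>\<Psi>(2)[OF F']]]
        operator_add[OF lin \<Phi>\<Psi>(2)[OF F] \<Phi>\<Psi>(2)[OF F']] \<Phi>\<Psi>(1)[OF F] \<Phi>\<Psi>(1)[OF F']
      by simp
  qed (use \<Phi>\<Psi>(2) in auto)
  have comm': "?\<Psi> (L.\<rho> g F) = \<rho> g (?\<Psi> F)" if g: "g \<in> carrier G" and F: "F \<in> L.V" for g F
    using comm[OF g \<Phi>\<Psi>(2)[OF F]] \<Psi>\<Phi>[OF rho_closed[OF \<Phi>\<Psi>(2)[OF F] g]] \<Phi>\<Psi>(1)[OF F] by simp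
  show ?thesis
    unfolding transported_mult_algebra_def L.mult_algebra_eq_commutant
  proof (intro equalityI subsetI)
    fix S assume "S \<in> (\<lambda>m. \<lambda>f\<in>V. ?\<Psi> (m (\<Phi> f))) ` L.commutant N"
    then show "S \<in> commutant N"
      using transport_commutant[OF L lin lin' comm comm'] by blast
  next
    fix S assume S: "S \<in> commutant N"
    let ?m = "\<lambda>F\<in>L.V. \<Phi> (S (?\<Psi> F))"
    have m: "?m \<in> L.commutant N"
      by (rule L.transport_commutant[OF induced_model_axioms lin' lin comm' comm S])
    have "S = (\<lambda>f\<in>V. ?\<Psi> (?m (\<Phi> f)))"
    proof (rule operator_eqI[OF commutantD(1)[OF S]])
      show "(\<lambda>f\<in>V. ?\<Psi> (?m (\<Phi> f))) \<in> endomorphisms V"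
        by (rule commutantD(1)[OF transport_commutant[OF L lin lin' comm comm' m]])
      show "S f = (\<lambda>f\<in>V. ?\<Psi> (?m (\<Phi> f))) f" if "f \<in> V" for f
        using that by (simp add: \<Phi>_closed \<Psi>\<Phi> endomorphism_closed[OF commutantD(1)[OF S]])
    qed
    then show "S \<in> (\<lambda>m. \<lambda>f\<in>V. ?\<Psi> (m (\<Phi> f))) ` L.commutant N"
      using m by blast
  qed
qed

lemma commutant_is_isotropic_algebra:
  assumes N: "maximal_isotropic G K \<iota> \<pi> N"
  shows "is_isotropic_algebra G X \<iota> \<pi> V \<rho> N (commutant N)"
  unfolding is_isotropic_algebra_def
proof (intro conjI ballI allI impI)
  show "\<exists>\<psi>\<in>central_characters G X \<iota> \<pi> N. \<exists>\<Phi>.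
      rep_isomorphism G V \<rho> (induced_space G \<pi> N \<psi>) (induced_rep G \<pi> N \<psi>) \<Phi>"
    by (rule isomorphic_model_exists[OF N]) blast
  fix \<psi> \<Phi> assume psi: "\<psi> \<in> central_characters G X \<iota> \<pi> N"
    and iso: "rep_isomorphism G V \<rho> (induced_space G \<pi> N \<psi>) (induced_rep G \<pi> N \<psi>) \<Phi>"
  have "induced_model G X K \<iota> \<pi> N \<psi>"
    by (intro induced_model.intro induced_model_axioms.intro heisenberg_group_axioms N psi)
  from transported_mult_algebra_eq_commutant[OF this iso]
  show "commutant N = transported_mult_algebra G \<pi> V N \<psi> \<Phi>" ..
qed

end

section \<open>Maximal inductive algebras\<close>

theorem theorem2p4:
  fixes G :: "('g, 'm) monoid_scheme" and X :: "'g topology"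
    and K :: "('k, 'n) monoid_scheme"
    and \<iota> :: "complex \<Rightarrow> 'g" and \<pi> :: "'g \<Rightarrow> 'k"
    and M0 :: "'k set" and \<xi>0 :: "'g \<Rightarrow> complex"
    and V :: "('g \<Rightarrow> complex) set" and \<rho> :: "'g \<Rightarrow> 'g operator"
    and A :: "'g operator set"
  assumes "heisenberg_group G X K \<iota> \<pi>"
    and "maximal_isotropic G K \<iota> \<pi> M0"
    and "\<xi>0 \<in> central_characters G X \<iota> \<pi> M0"
    and "V = induced_space G \<pi> M0 \<xi>0"
    and "\<rho> = induced_rep G \<pi> M0 \<xi>0"
    and "maximal_set (inductive_algebra G V \<rho>) A"
  shows "(\<exists>M. maximal_isotropic G K \<iota> \<pi> M \<and> is_isotropic_algebra G X \<iota> \<pi> V \<rho> M A) \<and>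
         maximal_set (abelian_subalgebra V) A \<and>
         (\<forall>ip. invariant_inner_product G V \<rho> ip \<longrightarrow> self_adjoint_algebra V ip A)"
proof -
  interpret induced_model G X K \<iota> \<pi> M0 \<xi>0
    using assms(1-3) by (intro induced_model.intro induced_model_axioms.intro)
  note A = assms(6)[unfolded assms(4,5)]
  have ind: "inductive_algebra G (induced_space G \<pi> M0 \<xi>0) (induced_rep G \<pi> M0 \<xi>0) A"
    using A unfolding maximal_set_def by blast
  then obtain N where N: "maximal_isotropic G K \<iota> \<pi> N" "A \<subseteq> commutant N"
    by (rule inductive_algebra_in_commutant)
  then have eq: "A = commutant N"
    using A commutant_inductive[OF N(1)] unfolding maximal_set_def by blast
  show ?thesis
    unfolding eq assms(4,5)
    using N(1) commutant_is_isotropic_algebra[OF N(1)] commutant_maximal_abelian[OF N(1)]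
      commutant_self_adjoint[OF N(1)] by blast
qed

end
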